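(* Let $\Omega=\bigcup_{i=1}^n(\alpha_i,\beta_i)$ be a finite union of finite open intervals as in the context, let $B=(b_{i,j})$ be a unitary $n\times n$ matrix, and let $\{U(t)\}_{t\in\mathbb R}$ be the unitary group associated to $\Omega$ and $B$. Then $\{U(t)\}$ satisfies the Forelli condition if and only if $B$ is a weighted permutation matrix.
   Context: Setting: $n\ge 1$, $-\infty<\alpha_1<\beta_1<\alpha_2<\beta_2<\dots<\alpha_n<\beta_n<\infty$, $\Omega=\bigcup_{i=1}^n(\alpha_i,\beta_i)$. $\mathscr D$ is the set of $f\in L^2(\Omega)$ absolutely continuous on each interval with $f'\in L^2(\Omega)$; $f(\alpha_i),f(\beta_i)$ denote the one-sided limits $f(\alpha_i+),f(\beta_i-)$, and $f(\vec\alpha)=(f(\alpha_i))_{i=1}^n$, $f(\vec\beta)=(f(\beta_i))_{i=1}^n$. For a unitary $n\times n$ matrix $B$, $\mathscr D_B=\{f\in\mathscr D: Bf(\vec\alpha)=f(\vec\beta)\}$, $D_Bf=\frac1{2\pi\mathrm i}f'$ with domain $\mathscr D_B$ (a self-adjoint operator), and $U(t)=\exp(2\pi\mathrm i tD_B)$, $t\in\mathbb R$. For $g\in L^\infty(\Omega)$ let $M_g$ be the multiplication operator $M_gf=gf$ on $L^2(\Omega)$, and $\mathcal M=\{M_g:g\in L^\infty(\Omega)\}$. $U(t)$ satisfies the Forelli condition if $U(t)\mathcal MU(t)^*=\mathcal M$; the group $\{U(t)\}$ satisfies the Forelli condition if $U(t)$ does for every $t\in\mathbb R$. A unitary matrix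 $B$ is a weighted permutation matrix if there is a permutation $\sigma$ of $\{1,\dots,n\}$ with $|b_{i,\sigma(i)}|=1$ for all $i$ (so $b_{i,j}=0$ for $j\ne\sigma(i)$). *)

theory Defs
  imports "HOL-Analysis.Analysis"
begin

text \<open>
  Elements of \<open>L\<^sup>2(M)\<close> are equivalence classes, modulo equality almost everywhere, of complex
  valued measurable functions whose squared modulus is integrable. Vector operations are
  defined through an arbitrary representative; the lemmas following these definitions show
  that the choice does not matter.
\<close>

type_synonym 'a fclass = "('a \<Rightarrow> complex) set"

definition L2_fun :: "'a measure \<Rightarrow> ('a \<Rightarrow> complex) set" where
  "L2_fun M = {f \<in> borel_measurable M. integrable M (\<lambda>x. (cmod (f x))\<^sup>2)}"

definition ae_rel :: "'a measure \<Rightarrow> (('a \<Rightarrow> complex) \<times> ('a \<Rightarrow> complex)) set" where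
  "ae_rel M = {(f, g). f \<in> L2_fun M \<and> g \<in> L2_fun M \<and> (AE x in M. f x = g x)}"

definition L2 :: "'a measure \<Rightarrow> 'a fclass set" where
  "L2 M = L2_fun M // ae_rel M"

definition cls :: "'a measure \<Rightarrow> ('a \<Rightarrow> complex) \<Rightarrow> 'a fclass" where
  "cls M f = ae_rel M `` {f}"

definition rep :: "'a fclass \<Rightarrow> 'a \<Rightarrow> complex" where
  "rep F = (SOME f. f \<in> F)"

definition l2_add :: "'a measure \<Rightarrow> 'a fclass \<Rightarrow> 'a fclass \<Rightarrow> 'a fclass" where
  "l2_add M F G = cls M (\<lambda>x. rep F x + rep G x)"

definition l2_diff :: "'a measure \<Rightarrow> 'a fclass \<Rightarrow> 'a fclass \<Rightarrow> 'a fclass" where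
  "l2_diff M F G = cls M (\<lambda>x. rep F x - rep G x)"

definition l2_scale :: "'a measure \<Rightarrow> complex \<Rightarrow> 'a fclass \<Rightarrow> 'a fclass" where
  "l2_scale M c F = cls M (\<lambda>x. c * rep F x)"

definition l2_inner :: "'a measure \<Rightarrow> 'a fclass \<Rightarrow> 'a fclass \<Rightarrow> complex" where
  "l2_inner M F G = (LINT x|M. rep F x * cnj (rep G x))"

definition l2_norm :: "'a measure \<Rightarrow> 'a fclass \<Rightarrow> real" where
  "l2_norm M F = sqrt (LINT x|M. (cmod (rep F x))\<^sup>2)"

lemma equiv_ae_rel: "equiv (L2_fun M) (ae_rel M)"
  by (rule equivI) (auto simp: ae_rel_def refl_on_def sym_def trans_def elim: AE_mp)

lemma cls_in_L2: "f \<in> L2_fun M \<Longrightarrow> cls M f \<in> L2 M"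
  by (simp add: L2_def cls_def quotientI)

lemma cls_eq_iff:
  "f \<in> L2_fun M \<Longrightarrow> g \<in> L2_fun M \<Longrightarrow> cls M f = cls M g \<longleftrightarrow> (AE x in M. f x = g x)"
  by (simp add: cls_def eq_equiv_class_iff[OF equiv_ae_rel]) (simp add: ae_rel_def)

lemma rep_cls:
  assumes "f \<in> L2_fun M"
  shows "rep (cls M f) \<in> L2_fun M" "AE x in M. rep (cls M f) x = f x"
proof -
  have "f \<in> cls M f"
    using assms by (auto simp: cls_def ae_rel_def)
  hence "rep (cls M f) \<in> cls M f"
    unfolding rep_def by (rule someI[where P = "\<lambda>g. g \<in> cls M f"])
  thus "rep (cls M f) \<in> L2_fun M" "AE x in M. rep (cls M f) x = f x"
    by (auto simp: cls_def ae_rel_def elim: AE_mp)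
qed

lemma rep_in_L2_fun:
  assumes "F \<in> L2 M"
  shows "rep F \<in> L2_fun M" "cls M (rep F) = F"
proof -
  obtain f where f: "f \<in> L2_fun M" "F = cls M f"
    using assms by (auto simp: L2_def cls_def elim: quotientE)
  thus "rep F \<in> L2_fun M" "cls M (rep F) = F"
    using rep_cls[OF f(1)] by (auto simp: cls_eq_iff)
qed

lemma L2_fun_scale: "f \<in> L2_fun M \<Longrightarrow> (\<lambda>x. c * f x) \<in> L2_fun M"
  by (auto simp: L2_fun_def norm_mult power_mult_distrib)

lemma L2_fun_add:
  assumes "f \<in> L2_fun M" "g \<in> L2_fun M"
  shows "(\<lambda>x. f x + g x) \<in> L2_fun M"
proof -
  have [measurable]: "f \<in> borel_measurable M" "g \<in> borel_measurable M"
    using assms by (auto simp: L2_fun_def)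
  have "integrable M (\<lambda>x. (cmod (f x + g x))\<^sup>2)"
  proof (rule Bochner_Integration.integrable_bound)
    show "integrable M (\<lambda>x. 2 * (cmod (f x))\<^sup>2 + 2 * (cmod (g x))\<^sup>2)"
      using assms by (auto simp: L2_fun_def)
    have "(cmod (a + b))\<^sup>2 \<le> 2 * (cmod a)\<^sup>2 + 2 * (cmod b)\<^sup>2" for a b
    proof -
      have "(cmod (a + b))\<^sup>2 \<le> (cmod a + cmod b)\<^sup>2"
        by (simp add: norm_triangle_ineq power_mono)
      also have "\<dots> \<le> 2 * (cmod a)\<^sup>2 + 2 * (cmod b)\<^sup>2"
        using zero_le_power2[of "cmod a - cmod b"] unfolding power2_sum power2_diff by linarith
      finally show ?thesis .
    qed
    thus "AE x in M. norm ((cmod (f x + g x))\<^sup>2) \<le> norm (2 * (cmod (f x))\<^sup>2 + 2 * (cmod (g x))\<^sup>2)"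
      by auto
  qed measurable
  thus ?thesis by (simp add: L2_fun_def)
qed

lemma L2_fun_diff:
  assumes "f \<in> L2_fun M" "g \<in> L2_fun M"
  shows "(\<lambda>x. f x - g x) \<in> L2_fun M"
  using L2_fun_add[OF assms(1) L2_fun_scale[OF assms(2), of "-1"]] by simp

lemma l2_add_cls:
  assumes f: "f \<in> L2_fun M" and g: "g \<in> L2_fun M"
  shows "l2_add M (cls M f) (cls M g) = cls M (\<lambda>x. f x + g x)"
  unfolding l2_add_def
  using rep_cls[OF f] rep_cls[OF g] f g
  by (subst cls_eq_iff) (auto intro: L2_fun_add elim: AE_mp)

lemma l2_diff_cls:
  assumes f: "f \<in> L2_fun M" and g: "g \<in> L2_fun M"
  shows "l2_diff M (cls M f) (cls M g) = cls M (\<lambda>x. f x - g x)"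
  unfolding l2_diff_def
  using rep_cls[OF f] rep_cls[OF g] f g
  by (subst cls_eq_iff) (auto intro: L2_fun_diff elim: AE_mp)

lemma l2_scale_cls:
  assumes f: "f \<in> L2_fun M"
  shows "l2_scale M c (cls M f) = cls M (\<lambda>x. c * f x)"
  unfolding l2_scale_def
  using rep_cls[OF f] f
  by (subst cls_eq_iff) (auto intro: L2_fun_scale elim: AE_mp)

lemma l2_inner_cls:
  assumes f: "f \<in> L2_fun M" and g: "g \<in> L2_fun M"
  shows "l2_inner M (cls M f) (cls M g) = (LINT x|M. f x * cnj (g x))"
proof -
  have [measurable]: "f \<in> borel_measurable M" "g \<in> borel_measurable M"
    "rep (cls M f) \<in> borel_measurable M" "rep (cls M g) \<in> borel_measurable M"
    using rep_cls(1)[OF f] rep_cls(1)[OF g] f g by (auto simp: L2_fun_def)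
  have [measurable]: "cnj \<in> borel_measurable borel"
    by (intro borel_measurable_continuous_onI continuous_intros)
  show ?thesis
    unfolding l2_inner_def
    by (rule integral_cong_AE) (use rep_cls(2)[OF f] rep_cls(2)[OF g] in \<open>auto elim: AE_mp\<close>)
qed

lemma l2_norm_cls:
  assumes f: "f \<in> L2_fun M"
  shows "l2_norm M (cls M f) = sqrt (LINT x|M. (cmod (f x))\<^sup>2)"
proof -
  have [measurable]: "f \<in> borel_measurable M" "rep (cls M f) \<in> borel_measurable M"
    using rep_cls(1)[OF f] f by (auto simp: L2_fun_def)
  have "(LINT x|M. (cmod (rep (cls M f) x))\<^sup>2) = (LINT x|M. (cmod (f x))\<^sup>2)"
    by (rule integral_cong_AE) (use rep_cls(2)[OF f] in \<open>auto elim: AE_mp\<close>)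
  thus ?thesis by (simp add: l2_norm_def)
qed

text \<open>
  Everywhere defined operators are extensional functions on the carrier, so that equality of
  operators is equality of functions. Unbounded operators are given by their graphs.
\<close>

definition l2_adjoint :: "'a measure \<Rightarrow> ('a fclass \<Rightarrow> 'a fclass) \<Rightarrow> 'a fclass \<Rightarrow> 'a fclass" where
  "l2_adjoint M T = (\<lambda>G\<in>L2 M. THE H. H \<in> L2 M \<and> (\<forall>F\<in>L2 M. l2_inner M (T F) G = l2_inner M F H))"

definition unitary_operator :: "'a measure \<Rightarrow> ('a fclass \<Rightarrow> 'a fclass) \<Rightarrow> bool" where
  "unitary_operator M T \<longleftrightarrow>
     T \<in> L2 M \<rightarrow>\<^sub>E L2 M \<and>
     (\<forall>F\<in>L2 M. \<forall>G\<in>L2 M. T (l2_add M F G) = l2_add M (T F) (T G)) \<and>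
     (\<forall>c. \<forall>F\<in>L2 M. T (l2_scale M c F) = l2_scale M c (T F)) \<and>
     (\<forall>F\<in>L2 M. \<forall>G\<in>L2 M. l2_inner M (T F) (T G) = l2_inner M F G) \<and>
     T ` L2 M = L2 M"

definition continuous_unitary_group :: "'a measure \<Rightarrow> (real \<Rightarrow> 'a fclass \<Rightarrow> 'a fclass) \<Rightarrow> bool" where
  "continuous_unitary_group M U \<longleftrightarrow>
     (\<forall>t. unitary_operator M (U t)) \<and>
     (\<forall>F\<in>L2 M. U 0 F = F) \<and>
     (\<forall>s t. \<forall>F\<in>L2 M. U (s + t) F = U s (U t F)) \<and>
     (\<forall>F\<in>L2 M. \<forall>s. ((\<lambda>t. l2_norm M (l2_diff M (U t F) (U s F))) \<longlongrightarrow> 0) (at s))"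

definition generator :: "'a measure \<Rightarrow> (real \<Rightarrow> 'a fclass \<Rightarrow> 'a fclass) \<Rightarrow> ('a fclass \<times> 'a fclass) set" where
  "generator M U = {(F, G). F \<in> L2 M \<and> G \<in> L2 M \<and>
     ((\<lambda>t. l2_norm M (l2_diff M (l2_scale M (of_real (1 / t)) (l2_diff M (U t F) F)) G)) \<longlongrightarrow> 0) (at 0)}"

text \<open>
  For a self-adjoint operator \<open>A\<close>, Stone's theorem says that \<open>exp (2 \<pi> \<i> t A)\<close> is the unique
  strongly continuous one-parameter unitary group whose infinitesimal generator is
  \<open>2 \<pi> \<i> A\<close>, with equality of domains. This is taken as the meaning of the exponential.
\<close>

definition is_exp_group ::
  "'a measure \<Rightarrow> ('a fclass \<times> 'a fclass) set \<Rightarrow> (real \<Rightarrow> 'a fclass \<Rightarrow> 'a fclass) \<Rightarrow> bool" where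
  "is_exp_group M A U \<longleftrightarrow>
     continuous_unitary_group M U \<and>
     generator M U = {(F, l2_scale M (2 * of_real pi * \<i>) G) | F G. (F, G) \<in> A}"

definition Linf_fun :: "'a measure \<Rightarrow> ('a \<Rightarrow> complex) set" where
  "Linf_fun M = {g \<in> borel_measurable M. \<exists>C. AE x in M. cmod (g x) \<le> C}"

definition mult_op :: "'a measure \<Rightarrow> ('a \<Rightarrow> complex) \<Rightarrow> 'a fclass \<Rightarrow> 'a fclass" where
  "mult_op M g = (\<lambda>F\<in>L2 M. cls M (\<lambda>x. g x * rep F x))"

definition mult_algebra :: "'a measure \<Rightarrow> ('a fclass \<Rightarrow> 'a fclass) set" where
  "mult_algebra M = mult_op M ` Linf_fun M"

definition forelli :: "'a measure \<Rightarrow> ('a fclass \<Rightarrow> 'a fclass) \<Rightarrow> bool" where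
  "forelli M T \<longleftrightarrow>
     (\<lambda>S. compose (L2 M) T (compose (L2 M) S (l2_adjoint M T))) ` mult_algebra M = mult_algebra M"

definition group_forelli :: "'a measure \<Rightarrow> (real \<Rightarrow> 'a fclass \<Rightarrow> 'a fclass) \<Rightarrow> bool" where
  "group_forelli M U \<longleftrightarrow> (\<forall>t. forelli M (U t))"

definition absolutely_continuous_fun_on :: "real set \<Rightarrow> (real \<Rightarrow> complex) \<Rightarrow> bool" where
  "absolutely_continuous_fun_on I f \<longleftrightarrow>
     (\<forall>e>0. \<exists>d>0. \<forall>P. finite P \<and> (\<forall>(a, b)\<in>P. a \<le> b \<and> {a..b} \<subseteq> I) \<and>
        pairwise (\<lambda>(a, b) (a', b'). {a<..<b} \<inter> {a'<..<b'} = {}) P \<and>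
        (\<Sum>(a, b)\<in>P. b - a) < d \<longrightarrow> (\<Sum>(a, b)\<in>P. cmod (f b - f a)) < e)"

definition region :: "('n \<Rightarrow> real) \<Rightarrow> ('n \<Rightarrow> real) \<Rightarrow> real set" where
  "region \<alpha> \<beta> = (\<Union>i. {\<alpha> i<..<\<beta> i})"

text \<open>
  The functions forming the domain \<open>\<D>\<close>. Absolutely continuous functions are differentiable
  almost everywhere, so the values of \<^const>\<open>vector_derivative\<close> at the remaining points do not
  affect membership in \<open>L\<^sup>2\<close>.
\<close>

definition AC_dom :: "('n \<Rightarrow> real) \<Rightarrow> ('n \<Rightarrow> real) \<Rightarrow> (real \<Rightarrow> complex) set" where
  "AC_dom \<alpha> \<beta> = {f \<in> L2_fun (lebesgue_on (region \<alpha> \<beta>)).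
     (\<forall>i. absolutely_continuous_fun_on {\<alpha> i<..<\<beta> i} f) \<and>
     (\<lambda>x. vector_derivative f (at x)) \<in> L2_fun (lebesgue_on (region \<alpha> \<beta>))}"

definition bc_dom :: "(('n::finite) \<Rightarrow> real) \<Rightarrow> ('n \<Rightarrow> real) \<Rightarrow> complex^'n^'n \<Rightarrow> (real \<Rightarrow> complex) set" where
  "bc_dom \<alpha> \<beta> B = {f \<in> AC_dom \<alpha> \<beta>.
     B *v (\<chi> i. Lim (at_right (\<alpha> i)) f) = (\<chi> i. Lim (at_left (\<beta> i)) f)}"

definition D_op ::
  "(('n::finite) \<Rightarrow> real) \<Rightarrow> ('n \<Rightarrow> real) \<Rightarrow> complex^'n^'n \<Rightarrow> (real fclass \<times> real fclass) set" where
  "D_op \<alpha> \<beta> B =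
     {(cls (lebesgue_on (region \<alpha> \<beta>)) f,
       cls (lebesgue_on (region \<alpha> \<beta>)) (\<lambda>x. 1 / (2 * of_real pi * \<i>) * vector_derivative f (at x))) | f.
      f \<in> bc_dom \<alpha> \<beta> B}"

definition conj_transpose :: "complex^'n^'m \<Rightarrow> complex^'m^'n" where
  "conj_transpose B = (\<chi> i j. cnj (B $ j $ i))"

definition unitary_matrix :: "complex^'n^'n \<Rightarrow> bool" where
  "unitary_matrix B \<longleftrightarrow> B ** conj_transpose B = mat 1 \<and> conj_transpose B ** B = mat 1"

definition weighted_permutation_matrix :: "complex^'n^'n \<Rightarrow> bool" where
  "weighted_permutation_matrix B \<longleftrightarrow>
     unitary_matrix B \<and> (\<exists>\<sigma>. bij \<sigma> \<and> (\<forall>i. cmod (B $ i $ \<sigma> i) = 1))"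

end

theory Submission
  imports Defs
begin

text \<open>
  Away from the endpoints the group \<open>U(t)\<close> is translation. Solving the Cauchy problem for a smooth bump
  supported in one interval shows that, for small \<open>t > 0\<close>, mass leaving the interval \<open>j\<close> at \<open>\<alpha>\<^sub>j\<close> reenters
  every interval \<open>i\<close> at \<open>\<beta>\<^sub>i\<close> with weight \<open>b\<^sub>i\<^sub>j\<close>; by duality \<open>U(-t) f\<close> is known for every \<open>f\<close> in \<open>L\<^sup>2\<close>.
  Near \<open>\<alpha>\<^sub>j\<close> it is the superposition, with weights from column \<open>j\<close>, of the values of \<open>f\<close> near all \<open>\<beta>\<^sub>i\<close>.
  If \<open>B\<close> is a weighted permutation matrix, \<open>U(-t)\<close> is thus a weighted composition operator, and conjugation
  by it maps the multiplication operators onto themselves; the group law extends this to all times.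
  Otherwise two intervals are superposed, and the conjugate of the multiplication by the indicator
  function of one of them is not a multiplication operator.
\<close>

section \<open>Hilbert space preliminaries and the Cauchy problem\<close>

text \<open>The exponential is characterised only through its generator, so uniqueness for the
  Cauchy problem is the way to learn anything about \<open>U t\<close>. The generator is
  differentiation: positive time moves functions to the left, and mass leaves an interval at its
  left endpoint. Classical solutions are written down only for bumps; pairing them with an arbitrary
  \<open>f\<close> replaces a density argument and explains why negative times appear, and why the
  weights of \<open>U (-t)\<close> are conjugated. Times are kept below the shortest length so that
  mass leaving one interval reenters the others without reaching a second left endpoint. Near
  \<open>\<alpha> j\<close> the function \<open>U (-t) f\<close> is then governed by column
  \<open>j\<close> alone, and the theorem reduces to how many entries of a column are nonzero. If
  there is just one, its phase occurs on both sides of the conjugation identity and cancels: the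
  symbols of the multiplication operators are moved by the bare permutation.\<close>

lemma L2_obtain:
  assumes "F \<in> L2 M"
  obtains f where "f \<in> L2_fun M" "F = cls M f"
  using rep_in_L2_fun[OF assms] by metis

lemma L2_fun_zero: "(\<lambda>x. 0) \<in> L2_fun M"
  by (simp add: L2_fun_def)

lemma l2_diff_in_L2 [intro]: "F \<in> L2 M \<Longrightarrow> G \<in> L2 M \<Longrightarrow> l2_diff M F G \<in> L2 M"
  unfolding l2_diff_def by (intro cls_in_L2 L2_fun_diff rep_in_L2_fun)

lemma l2_scale_in_L2 [intro]: "F \<in> L2 M \<Longrightarrow> l2_scale M c F \<in> L2 M"
  unfolding l2_scale_def by (intro cls_in_L2 L2_fun_scale rep_in_L2_fun)

text \<open>Minkowski's inequality follows from
  \<open>\<bar>a + b\<bar>\<^sup>2 \<le> (1 + \<eta>) \<bar>a\<bar>\<^sup>2 + (1 + 1/\<eta>) \<bar>b\<bar>\<^sup>2\<close> by taking for \<open>\<eta>\<close> the quotient of the norms.\<close>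

lemma L2_minkowski:
  assumes f: "f \<in> L2_fun M" and g: "g \<in> L2_fun M"
  shows "sqrt (LINT x|M. (cmod (f x + g x))\<^sup>2)
    \<le> sqrt (LINT x|M. (cmod (f x))\<^sup>2) + sqrt (LINT x|M. (cmod (g x))\<^sup>2)" (is "_ \<le> ?A + ?B")
proof -
  have if_: "integrable M (\<lambda>x. (cmod (f x))\<^sup>2)" and ig: "integrable M (\<lambda>x. (cmod (g x))\<^sup>2)"
    using f g by (auto simp: L2_fun_def)
  have ifg: "integrable M (\<lambda>x. (cmod (f x + g x))\<^sup>2)"
    using L2_fun_add[OF f g] by (simp add: L2_fun_def)
  have A2: "?A\<^sup>2 = (LINT x|M. (cmod (f x))\<^sup>2)" and B2: "?B\<^sup>2 = (LINT x|M. (cmod (g x))\<^sup>2)"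
    by simp_all
  have A0: "?A \<ge> 0" and B0: "?B \<ge> 0" by simp_all
  have "sqrt (LINT x|M. (cmod (f x + g x))\<^sup>2) \<le> ?A + ?B + e" if "e > 0" for e
  proof -
    \<comment> \<open>Adding \<open>e/2\<close> makes both numbers strictly positive, so that the
      quotient \<open>s\<close> makes sense even if one of the norms is zero.\<close>
    define A' B' where "A' = ?A + e/2" and "B' = ?B + e/2"
    have pos: "A' > 0" "B' > 0"
      using that A0 B0 unfolding A'_def B'_def by linarith+
    define s where "s = B' / A'"
    have s: "s > 0" using pos by (simp add: s_def)
    have pw: "(cmod (a + b))\<^sup>2 \<le> (1 + s) * (cmod a)\<^sup>2 + (1 + 1/s) * (cmod b)\<^sup>2" for a b
    proof -
      have "(cmod (a + b))\<^sup>2 \<le> (cmod a + cmod b)\<^sup>2"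
        by (simp add: norm_triangle_ineq power_mono)
      moreover have "(1 + s) * (cmod a)\<^sup>2 + (1 + 1/s) * (cmod b)\<^sup>2 - (cmod a + cmod b)\<^sup>2
          = (s * cmod a - cmod b)\<^sup>2 / s"
        using s by (simp add: field_simps power2_eq_square)
      moreover have "(s * cmod a - cmod b)\<^sup>2 / s \<ge> 0" using s by simp
      ultimately show ?thesis by linarith
    qed
    have "(LINT x|M. (cmod (f x + g x))\<^sup>2)
        \<le> (LINT x|M. (1 + s) * (cmod (f x))\<^sup>2 + (1 + 1/s) * (cmod (g x))\<^sup>2)"
      using pw by (intro integral_mono ifg Bochner_Integration.integrable_add
          integrable_mult_right if_ ig)
    also have "\<dots> = (1 + s) * ?A\<^sup>2 + (1 + 1/s) * ?B\<^sup>2"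
      using if_ ig by (simp only: A2 B2) (simp add: distrib_right)
    also have "\<dots> \<le> (1 + s) * A'\<^sup>2 + (1 + 1/s) * B'\<^sup>2"
      using s that A0 B0 by (intro add_mono mult_left_mono power_mono) (auto simp: A'_def B'_def)
    also have "\<dots> = (A' + B')\<^sup>2"
      using pos by (simp add: s_def field_simps power2_eq_square)
    finally have "sqrt (LINT x|M. (cmod (f x + g x))\<^sup>2) \<le> A' + B'"
      using pos by (simp add: real_le_lsqrt real_sqrt_le_iff real_le_rsqrt)
    thus ?thesis by (simp add: A'_def B'_def)
  qed
  thus ?thesis by (rule field_le_epsilon)
qed

lemma l2_norm_diff_triangle:
  assumes "X \<in> L2 M" "Y \<in> L2 M" "Z \<in> L2 M"
  shows "l2_norm M (l2_diff M X Z) \<le> l2_norm M (l2_diff M X Y) + l2_norm M (l2_diff M Y Z)"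
proof -
  obtain x y z where f: "x \<in> L2_fun M" "X = cls M x" "y \<in> L2_fun M" "Y = cls M y"
    "z \<in> L2_fun M" "Z = cls M z"
    using assms by (blast elim: L2_obtain)
  show ?thesis
    using L2_minkowski[OF L2_fun_diff[OF f(1,3)] L2_fun_diff[OF f(3,5)]] f
    by (simp add: l2_diff_cls l2_norm_cls L2_fun_diff)
qed

lemma l2_norm_diff_commute:
  assumes "X \<in> L2 M" "Y \<in> L2 M"
  shows "l2_norm M (l2_diff M X Y) = l2_norm M (l2_diff M Y X)"
proof -
  obtain x y where "x \<in> L2_fun M" "X = cls M x" "y \<in> L2_fun M" "Y = cls M y"
    using assms by (blast elim: L2_obtain)
  thus ?thesis
    by (simp add: l2_diff_cls l2_norm_cls L2_fun_diff norm_minus_commute)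
qed

lemma l2_norm_diff_zero_imp_eq:
  assumes "X \<in> L2 M" "Y \<in> L2 M" "l2_norm M (l2_diff M X Y) = 0"
  shows "X = Y"
proof -
  obtain x y where f: "x \<in> L2_fun M" "X = cls M x" "y \<in> L2_fun M" "Y = cls M y"
    using assms by (blast elim: L2_obtain)
  have d: "(\<lambda>t. x t - y t) \<in> L2_fun M" using f by (simp add: L2_fun_diff)
  have "(LINT t|M. (cmod (x t - y t))\<^sup>2) = 0"
    using assms(3) d f by (simp add: l2_diff_cls l2_norm_cls)
  moreover have "integrable M (\<lambda>t. (cmod (x t - y t))\<^sup>2)"
    using d by (simp add: L2_fun_def)
  ultimately have "AE t in M. x t = y t"
    by (subst (asm) integral_nonneg_eq_0_iff_AE) auto
  thus ?thesis using f by (simp add: cls_eq_iff)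
qed

text \<open>Two curves that pass through \<open>W\<close> with the same derivative \<open>V\<close>
  stay within \<open>o(h)\<close> of each other: this is the triangle inequality for their
  difference quotients with \<open>V\<close> as intermediate point, multiplied by
  \<open>\<bar>h\<bar>\<close>.\<close>

lemma l2_norm_quotient:
  assumes "X \<in> L2 M" "Y \<in> L2 M" "W \<in> L2 M" "V \<in> L2 M" "h \<noteq> 0"
  shows "l2_norm M (l2_diff M X Y) \<le> \<bar>h\<bar> *
    (l2_norm M (l2_diff M (l2_scale M (of_real (1 / h)) (l2_diff M X W)) V) +
     l2_norm M (l2_diff M (l2_scale M (of_real (1 / h)) (l2_diff M Y W)) V))"
proof -
  obtain x where x: "x \<in> L2_fun M" "X = cls M x" using assms(1) by (rule L2_obtain)
  obtain y where y: "y \<in> L2_fun M" "Y = cls M y" using assms(2) by (rule L2_obtain)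
  obtain w where w: "w \<in> L2_fun M" "W = cls M w" using assms(3) by (rule L2_obtain)
  obtain v where v: "v \<in> L2_fun M" "V = cls M v" using assms(4) by (rule L2_obtain)
  note f = x y w v
  define c where "c = (of_real (1 / h) :: complex)"
  have a: "(\<lambda>t. c * (x t - w t) - v t) \<in> L2_fun M" and b: "(\<lambda>t. c * (y t - w t) - v t) \<in> L2_fun M"
    using f by (auto intro!: L2_fun_diff L2_fun_scale)
  have b': "(\<lambda>t. - (c * (y t - w t) - v t)) \<in> L2_fun M"
    using L2_fun_scale[OF b, of "-1"] by simp
  have eq: "(c * (x t - w t) - v t) + - (c * (y t - w t) - v t) = c * (x t - y t)" for t
    by (simp add: algebra_simps)
  have "sqrt (LINT t|M. (cmod (c * (x t - y t)))\<^sup>2)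
    \<le> sqrt (LINT t|M. (cmod (c * (x t - w t) - v t))\<^sup>2) + sqrt (LINT t|M. (cmod (c * (y t - w t) - v t))\<^sup>2)"
    using L2_minkowski[OF a b'] unfolding eq norm_minus_cancel .
  moreover have "sqrt (LINT t|M. (cmod (c * (x t - y t)))\<^sup>2) = 1 / \<bar>h\<bar> * sqrt (LINT t|M. (cmod (x t - y t))\<^sup>2)"
    by (simp add: c_def norm_mult power_mult_distrib real_sqrt_mult real_sqrt_divide norm_divide power_divide)
  moreover have "d \<le> \<bar>h\<bar> * (a + b)" if "e \<le> a + b" "e = 1 / \<bar>h\<bar> * d" for a b d e :: real
  proof -
    have "d / \<bar>h\<bar> \<le> a + b" using that by simp
    thus ?thesis using assms(5) by (simp add: pos_divide_le_eq mult.commute)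
  qed
  ultimately have "sqrt (LINT t|M. (cmod (x t - y t))\<^sup>2) \<le> \<bar>h\<bar> *
      (sqrt (LINT t|M. (cmod (c * (x t - w t) - v t))\<^sup>2) + sqrt (LINT t|M. (cmod (c * (y t - w t) - v t))\<^sup>2))"
    by blast
  thus ?thesis
    unfolding c_def[symmetric]
    using f by (simp add: l2_diff_cls l2_scale_cls l2_norm_cls L2_fun_diff L2_fun_scale)
qed

lemma l2_inner_self:
  assumes "F \<in> L2 M"
  shows "l2_inner M F F = of_real ((l2_norm M F)\<^sup>2)"
proof -
  obtain f where f: "f \<in> L2_fun M" "F = cls M f" using assms by (rule L2_obtain)
  have "l2_inner M F F = (LINT x|M. of_real ((cmod (f x))\<^sup>2))"
    unfolding f(2) l2_inner_cls[OF f(1) f(1)]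
    by (intro Bochner_Integration.integral_cong) (auto simp flip: complex_norm_square)
  also have "\<dots> = of_real (LINT x|M. (cmod (f x))\<^sup>2)"
    by (rule integral_complex_of_real)
  finally show ?thesis by (simp add: f l2_norm_cls)
qed

section \<open>Elementary properties of unitary operators\<close>

lemma l2_norm_nonneg: "l2_norm M F \<ge> 0"
  by (simp add: l2_norm_def)

lemma unitary_operator_closed: "unitary_operator M T \<Longrightarrow> F \<in> L2 M \<Longrightarrow> T F \<in> L2 M"
  by (auto simp: unitary_operator_def)

lemma unitary_operator_inner:
  "unitary_operator M T \<Longrightarrow> F \<in> L2 M \<Longrightarrow> G \<in> L2 M \<Longrightarrow> l2_inner M (T F) (T G) = l2_inner M F G"
  by (simp add: unitary_operator_def)

lemma unitary_operator_norm:
  assumes "unitary_operator M T" "F \<in> L2 M"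
  shows "l2_norm M (T F) = l2_norm M F"
proof -
  have "l2_inner M (T F) (T F) = l2_inner M F F"
    using assms by (simp add: unitary_operator_inner)
  hence "(l2_norm M (T F))\<^sup>2 = (l2_norm M F)\<^sup>2"
    unfolding l2_inner_self[OF assms(2)] l2_inner_self[OF unitary_operator_closed[OF assms]]
    by (simp only: of_real_eq_iff)
  thus ?thesis by (simp add: l2_norm_nonneg)
qed

lemma unitary_operator_diff:
  assumes T: "unitary_operator M T" and "F \<in> L2 M" "G \<in> L2 M"
  shows "T (l2_diff M F G) = l2_diff M (T F) (T G)"
proof -
  have eq: "l2_diff M F G = l2_add M F (l2_scale M (-1) G)" if FG: "F \<in> L2 M" "G \<in> L2 M" for F G
  proof -
    obtain f g where f: "f \<in> L2_fun M" "F = cls M f" "g \<in> L2_fun M" "G = cls M g"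
      using FG by (blast elim: L2_obtain)
    have "(\<lambda>x. - g x) \<in> L2_fun M" using L2_fun_scale[OF f(3), of "-1"] by simp
    thus ?thesis using f by (simp add: l2_diff_cls l2_scale_cls l2_add_cls)
  qed
  show ?thesis
  proof -
    have "T (l2_add M F (l2_scale M (-1) G)) = l2_add M (T F) (T (l2_scale M (-1) G))"
      using T assms(2) l2_scale_in_L2[OF assms(3)] by (simp add: unitary_operator_def)
    also have "T (l2_scale M (-1) G) = l2_scale M (-1) (T G)"
      using T assms(3) by (simp add: unitary_operator_def)
    finally show ?thesis
      using eq assms(2,3) unitary_operator_closed[OF T] by simp
  qed
qed

text \<open>The norm of \<open>u t - U t (u 0)\<close> has derivative zero.\<close>

lemma generator_cauchy_unique:
  fixes a b :: real
  assumes U: "continuous_unitary_group M U"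
    and ab: "0 \<in> {a<..<b}"
    and u: "\<And>t. t \<in> {a<..<b} \<Longrightarrow> (u t, v t) \<in> generator M U"
    and du: "\<And>t. t \<in> {a<..<b} \<Longrightarrow>
      ((\<lambda>h. l2_norm M (l2_diff M (l2_scale M (of_real (1 / h)) (l2_diff M (u (t + h)) (u t))) (v t)))
        \<longlongrightarrow> 0) (at 0)"
    and t: "t \<in> {a<..<b}"
  shows "u t = U t (u 0)"
proof -
  have UU: "unitary_operator M (U t)" for t using U by (simp add: continuous_unitary_group_def)
  have Uadd: "U (s + t) F = U s (U t F)" if "F \<in> L2 M" for s t F
    using U that by (simp add: continuous_unitary_group_def)
  have U0: "U 0 F = F" if "F \<in> L2 M" for F
    using U that by (simp add: continuous_unitary_group_def)
  have uL: "u t \<in> L2 M" "v t \<in> L2 M" if "t \<in> {a<..<b}" for t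
    using u[OF that] by (auto simp: generator_def)
  define p where "p t = l2_norm M (l2_diff M (u t) (U t (u 0)))" for t
  have main: "(p has_field_derivative 0) (at t within {a<..<b})" if t: "t \<in> {a<..<b}" for t
  proof -
    \<comment> \<open>The curves \<open>u (t + h)\<close> and \<open>U h (u t)\<close> both have
      derivative \<open>v t\<close> at \<open>h = 0\<close>, the first by \<open>du\<close>, the
      second because \<open>(u t, v t)\<close> lies in the generator. Hence \<open>q\<close> tends
      to 0.\<close>
    define q where "q h = l2_norm M (l2_diff M (l2_scale M (of_real (1 / h)) (l2_diff M (u (t + h)) (u t))) (v t))
      + l2_norm M (l2_diff M (l2_scale M (of_real (1 / h)) (l2_diff M (U h (u t)) (u t))) (v t))" for h
    have "(q \<longlongrightarrow> 0 + 0) (at 0)"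
      unfolding q_def using u[OF t] by (intro tendsto_add du[OF t]) (simp add: generator_def)
    hence q0: "(q \<longlongrightarrow> 0) (at 0)" by simp
    have "((\<lambda>h. (p (t + h) - p t) / h) \<longlongrightarrow> 0) (at 0)"
    proof (rule Lim_null_comparison[OF _ q0])
      have "eventually (\<lambda>h. t + h \<in> {a<..<b}) (at 0)"
        using t by (intro eventually_at_in_open'[where A = "{a - t<..<b - t}", THEN eventually_mono]) auto
      moreover have "eventually (\<lambda>h. h \<noteq> (0::real)) (at 0)"
        by (simp add: eventually_at_filter)
      ultimately show "eventually (\<lambda>h. norm ((p (t + h) - p t) / h) \<le> q h) (at 0)"
      proof eventually_elim
        case (elim h)
        note L = uL[OF t] uL[OF ab] uL(1)[OF elim(1)]
        \<comment> \<open>By the group law \<open>Z = U h (U t (u 0))\<close>, and since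
          \<open>U h\<close> preserves the norm, the distance from \<open>Y\<close> to
          \<open>Z\<close> is \<open>p t\<close>. So \<open>p\<close> changes by at most the
          distance from \<open>X\<close> to \<open>Y\<close>, which is \<open>o(h)\<close>.\<close>
        define X Y Z where "X = u (t + h)" and "Y = U h (u t)" and "Z = U (t + h) (u 0)"
        have XYZ: "X \<in> L2 M" "Y \<in> L2 M" "Z \<in> L2 M"
          using L by (auto simp: X_def Y_def Z_def unitary_operator_closed[OF UU])
        have "Z = U h (U t (u 0))"
          unfolding Z_def using Uadd[of "u 0" h t] L by (simp add: add.commute)
        hence "l2_norm M (l2_diff M Y Z) = p t"
          unfolding Y_def p_def using L
          by (simp add: unitary_operator_diff[OF UU, symmetric] unitary_operator_norm[OF UU]
              unitary_operator_closed[OF UU] l2_diff_in_L2)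
        moreover have "l2_norm M (l2_diff M X Z) = p (t + h)"
          by (simp add: X_def Z_def p_def)
        ultimately have "\<bar>p (t + h) - p t\<bar> \<le> l2_norm M (l2_diff M X Y)"
          using l2_norm_diff_triangle[OF XYZ(1,2,3)] l2_norm_diff_triangle[OF XYZ(2,1,3)]
            l2_norm_diff_commute[OF XYZ(1,2)] by linarith
        also have "\<dots> \<le> \<bar>h\<bar> * q h"
          unfolding q_def X_def[symmetric] Y_def[symmetric]
          using l2_norm_quotient[OF XYZ(1,2) L(1,2) elim(2)] .
        finally show ?case
          using elim(2) by (simp add: field_simps)
      qed
    qed
    hence "(p has_field_derivative 0) (at t)"
      by (simp add: DERIV_def)
    thus ?thesis by (rule has_field_derivative_at_within)
  qed
  obtain c where c: "\<And>x. x \<in> {a<..<b} \<Longrightarrow> p x = c"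
    using has_field_derivative_zero_constant[OF _ main] by auto
  have "p 0 = 0"
  proof -
    obtain f where f: "f \<in> L2_fun M" "u 0 = cls M f"
      using uL(1)[OF ab] by (rule L2_obtain)
    show ?thesis
      unfolding p_def U0[OF uL(1)[OF ab]] unfolding f(2)
      using f(1) by (simp add: l2_diff_cls l2_norm_cls L2_fun_zero)
  qed
  hence "p t = 0" using c[OF t] c[OF ab] by simp
  thus ?thesis
    unfolding p_def
    by (rule l2_norm_diff_zero_imp_eq[OF uL(1)[OF t] unitary_operator_closed[OF UU uL(1)[OF ab]]])
qed

section \<open>The evolution of smooth bumps\<close>

text \<open>One continuous derivative is enough for membership in the domain. The derivative is a
  parameter so that the generator can be evaluated on explicit functions. If
  \<open>d \<le> c\<close>, the interval is empty and the bump vanishes.\<close>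

definition bump :: "real \<Rightarrow> real \<Rightarrow> (real \<Rightarrow> complex) \<Rightarrow> (real \<Rightarrow> complex) \<Rightarrow> bool" where
  "bump c d \<phi> \<phi>' \<longleftrightarrow>
     (\<forall>x. (\<phi> has_vector_derivative \<phi>' x) (at x)) \<and> continuous_on UNIV \<phi>' \<and>
     (\<forall>x. x \<notin> {c<..<d} \<longrightarrow> \<phi> x = 0 \<and> \<phi>' x = 0)"

text \<open>Compact support makes the derivative uniformly continuous, and the mean value inequality
  passes this on to the difference quotients. Uniformity in \<open>x\<close> is what later gives
  convergence in norm.\<close>

lemma bump_uniform_quotient:
  assumes b: "bump c d \<phi> \<phi>'" and e: "e > 0"
  shows "\<forall>\<^sub>F h in at 0. \<forall>x. cmod (of_real (1 / h) * (\<phi> (x + h) - \<phi> x) - \<phi>' x) \<le> e"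
proof -
  \<comment> \<open>The margin of 1 handles pairs of points at distance less than 1: if one of them
    is outside the enlarged interval, both are outside the support.\<close>
  have "uniformly_continuous_on {c - 1..d + 1} \<phi>'"
    using b by (intro compact_uniformly_continuous) (auto simp: bump_def elim: continuous_on_subset)
  then obtain r where r: "r > 0"
    "\<And>x y. x \<in> {c - 1..d + 1} \<Longrightarrow> y \<in> {c - 1..d + 1} \<Longrightarrow> dist y x < r \<Longrightarrow> dist (\<phi>' y) (\<phi>' x) < e"
    using e unfolding uniformly_continuous_on_def by metis
  have uc: "cmod (\<phi>' y - \<phi>' x) \<le> e" if "\<bar>y - x\<bar> < min r 1" for x y
  proof (cases "x \<in> {c - 1..d + 1} \<and> y \<in> {c - 1..d + 1}")
    case True
    thus ?thesis using r(2)[of x y] that by (auto simp: dist_norm)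
  next
    case False
    hence "x \<notin> {c<..<d}" "y \<notin> {c<..<d}" using that by auto
    hence "\<phi>' x = 0" "\<phi>' y = 0" using b unfolding bump_def by blast+
    thus ?thesis using e by simp
  qed
  have "\<forall>\<^sub>F h in at 0. \<bar>h\<bar> < min r 1 \<and> h \<noteq> 0"
    unfolding eventually_at using r(1) by (intro exI[of _ "min r 1"]) (auto simp: dist_norm)
  thus ?thesis
  proof eventually_elim
    case (elim h)
    show ?case
    proof
      fix x
      have "norm (\<phi> (x + h) - \<phi> x - (x + h - x) *\<^sub>R \<phi>' x) \<le> norm (x + h - x) * e"
      proof (rule vector_differentiable_bound_linearization[where S = "closed_segment x (x + h)"])
        show "(\<phi> has_vector_derivative \<phi>' y) (at y within closed_segment x (x + h))" for y
          using b by (auto simp: bump_def intro: has_vector_derivative_at_within)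
        show "norm (\<phi>' y - \<phi>' x) \<le> e" if "y \<in> closed_segment x (x + h)" for y
          using that elim by (intro uc) (auto simp: closed_segment_eq_real_ivl split: if_splits)
      qed auto
      moreover have "of_real (1 / h) * (\<phi> (x + h) - \<phi> x) - \<phi>' x
          = (\<phi> (x + h) - \<phi> x - (x + h - x) *\<^sub>R \<phi>' x) / of_real h"
        using elim by (simp add: field_simps scaleR_conv_of_real)
      ultimately show "cmod (of_real (1 / h) * (\<phi> (x + h) - \<phi> x) - \<phi>' x) \<le> e"
        using elim by (simp add: norm_divide field_simps)
    qed
  qed
qed

lemma bump_shift_has_vector_derivative:
  assumes "bump c d \<phi> \<phi>'"
  shows "((\<lambda>x. \<phi> (x + s)) has_vector_derivative \<phi>' (x + s)) (at x)"
proof -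
  have "(\<phi> has_vector_derivative \<phi>' (x + s)) (at (x + s))"
    using assms by (simp add: bump_def)
  thus ?thesis
    using vector_diff_chain_at[of "\<lambda>x. x + s" 1 x \<phi> "\<phi>' (x + s)"]
    by (simp add: o_def has_vector_derivative_add_const)
qed

lemma bump_continuous:
  assumes "bump c d \<phi> \<phi>'"
  shows "continuous_on UNIV \<phi>" "continuous_on UNIV \<phi>'"
  using assms by (auto simp: bump_def continuous_on_eq_continuous_at intro: has_vector_derivative_continuous)

lemma bump_outside: "bump c d \<phi> \<phi>' \<Longrightarrow> x \<notin> {c<..<d} \<Longrightarrow> \<phi> x = 0 \<and> \<phi>' x = 0"
  by (simp add: bump_def)

section \<open>Functions assembled from one piece per interval\<close>

locale intervals =
  fixes \<alpha> \<beta> :: "'n::{finite,linorder} \<Rightarrow> real"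
  assumes len: "\<alpha> i < \<beta> i"
    and sep: "i < j \<Longrightarrow> \<beta> i < \<alpha> j"
begin

definition \<Omega> :: "real set" where "\<Omega> = region \<alpha> \<beta>"

definition \<mu> :: "real measure" where "\<mu> = lebesgue_on \<Omega>"

definition I :: "'n \<Rightarrow> real set" where "I k = {\<alpha> k<..<\<beta> k}"

text \<open>The pieces live on the whole line, so that translates and values at the endpoints need
  no extension. The intervals being disjoint, at most one summand is nonzero; writing a sum makes
  measurability and linearity immediate.\<close>

definition glue :: "('n \<Rightarrow> real \<Rightarrow> complex) \<Rightarrow> real \<Rightarrow> complex" where
  "glue g x = (\<Sum>k\<in>UNIV. if x \<in> I k then g k x else 0)"

lemma I_disjoint: "x \<in> I i \<Longrightarrow> x \<in> I j \<Longrightarrow> i = j"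
  using sep[of i j] sep[of j i] by (cases i j rule: linorder_cases) (auto simp: I_def)

lemma \<Omega>_eq: "\<Omega> = (\<Union>k. I k)"
  by (simp add: \<Omega>_def region_def I_def)

lemma I_subset: "I k \<subseteq> \<Omega>"
  by (auto simp: \<Omega>_eq)

lemma \<Omega>_cases:
  assumes "x \<in> \<Omega>"
  obtains k where "x \<in> I k"
  using assms by (auto simp: \<Omega>_eq)

lemma \<Omega>_lmeasurable: "\<Omega> \<in> lmeasurable"
  unfolding \<Omega>_eq I_def by (intro fmeasurable.finite_UN) auto

lemma sets_I [measurable, simp]: "I k \<in> sets lebesgue"
  by (simp add: I_def)

lemma sets_\<Omega> [measurable, simp]: "\<Omega> \<in> sets lebesgue"
  using \<Omega>_lmeasurable by (rule fmeasurableD)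

lemma space_mu [simp]: "space \<mu> = \<Omega>"
  by (simp add: \<mu>_def)

lemma finite_measure_mu: "finite_measure \<mu>"
  unfolding \<mu>_def by (rule finite_measure_lebesgue_on[OF \<Omega>_lmeasurable])

lemma glue_eq: "x \<in> I k \<Longrightarrow> glue g x = g k x"
proof -
  assume x: "x \<in> I k"
  have "glue g x = (\<Sum>i\<in>UNIV. if i = k then g k x else 0)"
    unfolding glue_def using x by (intro sum.cong) (auto dest: I_disjoint)
  thus ?thesis by simp
qed

lemma continuous_measurable_lebesgue:
  "continuous_on UNIV (f :: real \<Rightarrow> complex) \<Longrightarrow> f \<in> borel_measurable lebesgue"
  by (rule measurable_completion) (simp add: borel_measurable_continuous_onI)

lemma glue_measurable:
  assumes "\<And>k. g k \<in> borel_measurable lebesgue"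
  shows "glue g \<in> borel_measurable lebesgue" "glue g \<in> borel_measurable \<mu>"
proof -
  show *: "glue g \<in> borel_measurable lebesgue"
    unfolding glue_def
    by (intro borel_measurable_sum measurable_If assms) auto
  thus "glue g \<in> borel_measurable \<mu>"
    unfolding \<mu>_def by (rule measurable_restrict_space1)
qed

text \<open>On a set of finite measure a uniform bound is a bound in norm; the second claim turns
  uniform estimates of difference quotients into convergence in \<open>L2\<close>.\<close>

lemma bounded_L2:
  assumes f: "f \<in> borel_measurable \<mu>" and C: "\<And>x. x \<in> \<Omega> \<Longrightarrow> cmod (f x) \<le> C"
  shows "f \<in> L2_fun \<mu>" "l2_norm \<mu> (cls \<mu> f) \<le> \<bar>C\<bar> * sqrt (measure \<mu> \<Omega>)"
proof -
  interpret finite_measure \<mu> by (rule finite_measure_mu)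
  have C': "(cmod (f x))\<^sup>2 \<le> C\<^sup>2" if "x \<in> \<Omega>" for x
    using C[OF that] by (intro power_mono) auto
  have int: "integrable \<mu> (\<lambda>x. (cmod (f x))\<^sup>2)"
    using C' f by (intro integrable_const_bound[where B = "C\<^sup>2"]) auto
  thus L2: "f \<in> L2_fun \<mu>" using f by (simp add: L2_fun_def)
  have "(LINT x|\<mu>. (cmod (f x))\<^sup>2) \<le> (LINT x|\<mu>. C\<^sup>2)"
    using int C' by (intro integral_mono) auto
  also have "\<dots> = C\<^sup>2 * measure \<mu> \<Omega>" by simp
  finally have "sqrt (LINT x|\<mu>. (cmod (f x))\<^sup>2) \<le> sqrt (C\<^sup>2 * measure \<mu> \<Omega>)" by simp
  thus "l2_norm \<mu> (cls \<mu> f) \<le> \<bar>C\<bar> * sqrt (measure \<mu> \<Omega>)"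
    by (simp add: l2_norm_cls[OF L2] real_sqrt_mult)
qed

lemma glue_bounded:
  assumes "\<And>k. continuous_on UNIV (g k)"
  obtains C where "C > 0" "\<And>k x. x \<in> {\<alpha> k..\<beta> k} \<Longrightarrow> cmod (g k x) \<le> C"
proof -
  have "\<exists>C. \<forall>x\<in>{\<alpha> k..\<beta> k}. cmod (g k x) \<le> C" for k
    using compact_continuous_image[OF continuous_on_subset[OF assms subset_UNIV], of "{\<alpha> k..\<beta> k}" k]
    by (auto dest!: compact_imp_bounded simp: bounded_iff)
  then obtain C where C: "\<And>k x. x \<in> {\<alpha> k..\<beta> k} \<Longrightarrow> cmod (g k x) \<le> C k" by metis
  show ?thesis
  proof
    \<comment> \<open>The added 1 makes the common bound strictly positive, so that it may be used
      as a divisor.\<close>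
    show "(\<Sum>k\<in>UNIV. \<bar>C k\<bar>) + 1 > 0" by (simp add: sum_nonneg add_nonneg_pos)
    fix k x assume "x \<in> {\<alpha> k..\<beta> k}"
    hence "cmod (g k x) \<le> \<bar>C k\<bar>" using C[of x k] by linarith
    also have "\<dots> \<le> (\<Sum>k\<in>UNIV. \<bar>C k\<bar>)" by (intro member_le_sum) auto
    finally show "cmod (g k x) \<le> (\<Sum>k\<in>UNIV. \<bar>C k\<bar>) + 1" by simp
  qed
qed

lemma glue_L2:
  assumes "\<And>k. continuous_on UNIV (g k)"
  shows "glue g \<in> L2_fun \<mu>"
proof -
  obtain C where C: "C > 0" "\<And>k x. x \<in> {\<alpha> k..\<beta> k} \<Longrightarrow> cmod (g k x) \<le> C"
    using assms by (rule glue_bounded[of g]) blast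
  moreover have "cmod (glue g x) \<le> C" if "x \<in> \<Omega>" for x
  proof -
    obtain k where "x \<in> I k" using \<open>x \<in> \<Omega>\<close> by (rule \<Omega>_cases)
    thus ?thesis using C(2)[of x k] by (simp add: glue_eq) (simp add: I_def)
  qed
  ultimately show ?thesis
    by (intro bounded_L2(1)[where C = C] glue_measurable(2) continuous_measurable_lebesgue assms)
qed

section \<open>Regularity and boundary values of glued functions\<close>

lemma glue_vector_derivative:
  assumes "\<And>k x. (g k has_vector_derivative g' k x) (at x)" and x: "x \<in> I k"
  shows "(glue g has_vector_derivative g' k x) (at x)"
proof (rule has_vector_derivative_transform_within_open[OF assms(1), where S = "I k"])
  show "open (I k)" by (simp add: I_def)
qed (use x in \<open>auto simp: glue_eq\<close>)

text \<open>A bound \<open>C\<close> for the derivative on the closed interval is a Lipschitz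
  constant, so \<open>e / C\<close> serves as the modulus of absolute continuity.\<close>

lemma glue_AC:
  assumes g: "\<And>k x. (g k has_vector_derivative g' k x) (at x)" and g': "\<And>k. continuous_on UNIV (g' k)"
  shows "absolutely_continuous_fun_on (I k) (glue g)"
proof -
  obtain C where C: "C > 0" "\<And>k x. x \<in> {\<alpha> k..\<beta> k} \<Longrightarrow> cmod (g' k x) \<le> C"
    using g' by (rule glue_bounded[of g']) blast
  have lip: "cmod (glue g b - glue g a) \<le> C * (b - a)" if "a \<in> I k" "b \<in> I k" "a \<le> b" for a b
  proof -
    have "norm (g k b - g k a) \<le> C * norm (b - a)"
    proof (rule differentiable_bound[of "{\<alpha> k..\<beta> k}" "g k" "\<lambda>x h. h *\<^sub>R g' k x"])
      show "(g k has_derivative (\<lambda>h. h *\<^sub>R g' k x)) (at x within {\<alpha> k..\<beta> k})" for x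
        using g[of k x] by (auto simp: has_vector_derivative_def intro: has_derivative_at_withinI)
      show "onorm (\<lambda>h. h *\<^sub>R g' k x) \<le> C" if "x \<in> {\<alpha> k..\<beta> k}" for x
        using C(2)[OF that] by (intro onorm_le) (metis abs_ge_zero mult.commute mult_right_mono norm_scaleR real_norm_def)
    qed (use that in \<open>auto simp: I_def\<close>)
    thus ?thesis using that by (simp add: glue_eq)
  qed
  show ?thesis
    unfolding absolutely_continuous_fun_on_def
  proof (intro allI impI)
    fix e :: real assume e: "e > 0"
    show "\<exists>d>0. \<forall>P. finite P \<and> (\<forall>(a, b)\<in>P. a \<le> b \<and> {a..b} \<subseteq> I k) \<and>
        pairwise (\<lambda>(a, b) (a', b'). {a<..<b} \<inter> {a'<..<b'} = {}) P \<and>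
        (\<Sum>(a, b)\<in>P. b - a) < d \<longrightarrow> (\<Sum>(a, b)\<in>P. cmod (glue g b - glue g a)) < e"
    proof (intro exI[of _ "e / C"] conjI allI impI)
      show "e / C > 0" using e C(1) by simp
      fix P assume P: "finite P \<and> (\<forall>(a, b)\<in>P. a \<le> b \<and> {a..b} \<subseteq> I k) \<and>
        pairwise (\<lambda>(a, b) (a', b'). {a<..<b} \<inter> {a'<..<b'} = {}) P \<and> (\<Sum>(a, b)\<in>P. b - a) < e / C"
      have "(\<Sum>(a, b)\<in>P. cmod (glue g b - glue g a)) \<le> (\<Sum>(a, b)\<in>P. C * (b - a))"
      proof (rule sum_mono, clarify)
        fix a b assume "(a, b) \<in> P"
        hence "a \<le> b \<and> {a..b} \<subseteq> I k" using P by blast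
        hence "a \<le> b" "a \<in> I k" "b \<in> I k" by auto
        thus "cmod (glue g b - glue g a) \<le> C * (b - a)" by (intro lip)
      qed
      also have "\<dots> = C * (\<Sum>(a, b)\<in>P. b - a)" by (simp add: sum_distrib_left case_prod_unfold)
      also have "\<dots> < e" using P C(1) by (simp add: field_simps)
      finally show "(\<Sum>(a, b)\<in>P. cmod (glue g b - glue g a)) < e" .
    qed
  qed
qed

lemma glue_Lim:
  assumes "\<And>k. continuous_on UNIV (g k)"
  shows "Lim (at_right (\<alpha> k)) (glue g) = g k (\<alpha> k)" "Lim (at_left (\<beta> k)) (glue g) = g k (\<beta> k)"
proof -
  have ct: "isCont (g k) x" for x
    using assms by (simp add: continuous_on_eq_continuous_at)
  have "(g k \<longlongrightarrow> g k (\<alpha> k)) (at_right (\<alpha> k))"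
    using ct isContD tendsto_within_subset by blast
  moreover have "\<forall>\<^sub>F x in at_right (\<alpha> k). g k x = glue g x"
    using eventually_at_right_real[OF len[of k]]
    by (auto elim!: eventually_mono simp: glue_eq I_def)
  ultimately show "Lim (at_right (\<alpha> k)) (glue g) = g k (\<alpha> k)"
    by (intro tendsto_Lim) (auto elim: Lim_transform_eventually)
  have "(g k \<longlongrightarrow> g k (\<beta> k)) (at_left (\<beta> k))"
    using ct isContD tendsto_within_subset by blast
  moreover have "\<forall>\<^sub>F x in at_left (\<beta> k). g k x = glue g x"
    using eventually_at_left_real[OF len[of k]]
    by (auto elim!: eventually_mono simp: glue_eq I_def)
  ultimately show "Lim (at_left (\<beta> k)) (glue g) = g k (\<beta> k)"
    by (intro tendsto_Lim) (auto elim: Lim_transform_eventually)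
qed

lemma cls_cong:
  assumes "f \<in> L2_fun \<mu>" "g \<in> borel_measurable \<mu>" "\<And>x. x \<in> \<Omega> \<Longrightarrow> f x = g x"
  shows "g \<in> L2_fun \<mu>" "cls \<mu> f = cls \<mu> g"
proof -
  have "integrable \<mu> (\<lambda>x. (cmod (g x))\<^sup>2)"
    using assms by (subst Bochner_Integration.integrable_cong[OF refl, of _ _ "\<lambda>x. (cmod (f x))\<^sup>2"]) (auto simp: L2_fun_def)
  thus g: "g \<in> L2_fun \<mu>" using assms by (simp add: L2_fun_def)
  show "cls \<mu> f = cls \<mu> g"
    using assms by (subst cls_eq_iff[OF assms(1) g]) auto
qed


text \<open>The factor \<open>1 / (2 * pi * \<i>)\<close> in the operator cancels against the factor
  in the exponent: the generator is plain differentiation on functions satisfying the boundary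
  condition.\<close>

lemma generator_glue:
  assumes U: "is_exp_group \<mu> (D_op \<alpha> \<beta> B) U"
    and g: "\<And>k x. (g k has_vector_derivative g' k x) (at x)" and g': "\<And>k. continuous_on UNIV (g' k)"
    and bc: "\<And>i. (\<Sum>k\<in>UNIV. B $ i $ k * g k (\<alpha> k)) = g i (\<beta> i)"
  shows "(cls \<mu> (glue g), cls \<mu> (glue g')) \<in> generator \<mu> U"
proof -
  have gc: "continuous_on UNIV (g k)" for k
    using g by (auto simp: continuous_on_eq_continuous_at intro: has_vector_derivative_continuous)
  have vd: "vector_derivative (glue g) (at x) = glue g' x" if "x \<in> \<Omega>" for x
  proof -
    obtain k where k: "x \<in> I k" using \<open>x \<in> \<Omega>\<close> by (rule \<Omega>_cases)
    thus ?thesis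
      using vector_derivative_at[OF glue_vector_derivative[OF g k]] by (simp add: glue_eq)
  qed
  have g'L: "glue g' \<in> L2_fun \<mu>" by (rule glue_L2[OF g'])
  \<comment> \<open>The formal derivative is identified with \<open>glue g'\<close> on
    \<open>\<Omega>\<close> only, so measurability and square integrability are transferred from
    there.\<close>
  have vm: "(\<lambda>x. vector_derivative (glue g) (at x)) \<in> borel_measurable \<mu>"
    using g'L vd by (subst measurable_cong[of _ _ "glue g'"]) (auto simp: L2_fun_def)
  note vL = cls_cong[OF g'L vm vd[symmetric]]
  have "glue g \<in> AC_dom \<alpha> \<beta>"
    unfolding AC_dom_def
    using glue_L2[of g, OF gc] vL(1) glue_AC[of g g', OF g g'] by (simp add: \<mu>_def \<Omega>_def I_def)
  moreover have "B *v (\<chi> i. Lim (at_right (\<alpha> i)) (glue g)) = (\<chi> i. Lim (at_left (\<beta> i)) (glue g))"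
    using bc by (simp add: glue_Lim[of g, OF gc] matrix_vector_mult_def vec_eq_iff)
  ultimately have dom: "glue g \<in> bc_dom \<alpha> \<beta> B"
    by (simp add: bc_dom_def)
  define v where "v = (\<lambda>x. 1 / (2 * of_real pi * \<i>) * vector_derivative (glue g) (at x))"
  have v: "v \<in> L2_fun \<mu>" unfolding v_def by (intro L2_fun_scale vL(1))
  have D: "(cls \<mu> (glue g), cls \<mu> v) \<in> D_op \<alpha> \<beta> B"
    unfolding D_op_def v_def \<mu>_def \<Omega>_def using dom by blast
  have "l2_scale \<mu> (2 * of_real pi * \<i>) (cls \<mu> v) = cls \<mu> (\<lambda>x. vector_derivative (glue g) (at x))"
    unfolding l2_scale_cls[OF v] by (simp add: v_def)
  also have "\<dots> = cls \<mu> (glue g')" using vL(2) by simp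
  finally have "cls \<mu> (glue g') = l2_scale \<mu> (2 * of_real pi * \<i>) (cls \<mu> v)" ..
  thus ?thesis
    using U D unfolding is_exp_group_def by blast
qed

lemma glue_diff: "glue f x - glue g x = glue (\<lambda>k x. f k x - g k x) x"
  by (simp add: glue_def flip: sum_subtractf) (intro sum.cong, auto)

lemma glue_mult: "c * glue f x = glue (\<lambda>k x. c * f k x) x"
  by (simp add: glue_def sum_distrib_left) (intro sum.cong, auto)

text \<open>Since \<open>\<Omega>\<close> has finite measure, a family whose pieces have uniformly
  convergent difference quotients is a differentiable curve in \<open>L2\<close>, as uniqueness for
  the Cauchy problem demands.\<close>

lemma glue_quotient_tendsto:
  assumes g: "\<And>s k. continuous_on UNIV (g s k)" and g': "\<And>k. continuous_on UNIV (g' k)"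
    and lim: "\<And>e. e > 0 \<Longrightarrow> \<forall>\<^sub>F h in at 0. \<forall>k x. cmod (of_real (1 / h) * (g (t + h) k x - g t k x) - g' k x) \<le> e"
  shows "((\<lambda>h. l2_norm \<mu> (l2_diff \<mu> (l2_scale \<mu> (of_real (1 / h))
            (l2_diff \<mu> (cls \<mu> (glue (g (t + h)))) (cls \<mu> (glue (g t))))) (cls \<mu> (glue g'))))
        \<longlongrightarrow> 0) (at 0)"
proof (rule tendstoI)
  fix e :: real assume e: "e > 0"
  \<comment> \<open>The summand 1 keeps the denominator positive without computing the measure; the
    factor 2 leaves room for a strict inequality.\<close>
  define r where "r = e / (2 * (sqrt (measure \<mu> \<Omega>) + 1))"
  have m0: "sqrt (measure \<mu> \<Omega>) \<ge> 0" by simp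
  have r: "r > 0" using e m0 by (simp add: r_def add_nonneg_pos)
  have "r * sqrt (measure \<mu> \<Omega>) \<le> r * (sqrt (measure \<mu> \<Omega>) + 1)"
    using r by (intro mult_left_mono) auto
  also have "\<dots> = e / 2"
  proof -
    have "e / (2 * s) * s = e / 2" if "s > 0" for s :: real using that by simp
    thus ?thesis unfolding r_def using m0 by (metis add_nonneg_pos zero_less_one)
  qed
  also have "\<dots> < e" using e by simp
  finally have rs: "r * sqrt (measure \<mu> \<Omega>) < e" .
  show "\<forall>\<^sub>F h in at 0. dist (l2_norm \<mu> (l2_diff \<mu> (l2_scale \<mu> (of_real (1 / h))
            (l2_diff \<mu> (cls \<mu> (glue (g (t + h)))) (cls \<mu> (glue (g t))))) (cls \<mu> (glue g')))) 0 < e"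
    using lim[OF r]
  proof eventually_elim
    case (elim h)
    define c where "c = (of_real (1 / h) :: complex)"
    define q where "q k x = c * (g (t + h) k x - g t k x) - g' k x" for k x
    have L: "glue (g (t + h)) \<in> L2_fun \<mu>" "glue (g t) \<in> L2_fun \<mu>" "glue g' \<in> L2_fun \<mu>"
      by (intro glue_L2 g g')+
    have "l2_diff \<mu> (l2_scale \<mu> c (l2_diff \<mu> (cls \<mu> (glue (g (t + h)))) (cls \<mu> (glue (g t))))) (cls \<mu> (glue g'))
      = cls \<mu> (\<lambda>x. c * (glue (g (t + h)) x - glue (g t) x) - glue g' x)"
      using L by (simp add: l2_diff_cls l2_scale_cls L2_fun_diff L2_fun_scale)
    also have "\<dots> = cls \<mu> (glue q)"
      unfolding q_def glue_diff glue_mult ..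
    finally have eq: "l2_diff \<mu> (l2_scale \<mu> c (l2_diff \<mu> (cls \<mu> (glue (g (t + h)))) (cls \<mu> (glue (g t))))) (cls \<mu> (glue g')) = cls \<mu> (glue q)" .
    have "l2_norm \<mu> (cls \<mu> (glue q)) \<le> \<bar>r\<bar> * sqrt (measure \<mu> \<Omega>)"
    proof (rule bounded_L2(2))
      show "glue q \<in> borel_measurable \<mu>"
        unfolding q_def using g g'
        by (intro glue_measurable(2) continuous_measurable_lebesgue continuous_intros)
      show "cmod (glue q x) \<le> r" if "x \<in> \<Omega>" for x
      proof -
        obtain k where k: "x \<in> I k" using \<open>x \<in> \<Omega>\<close> by (rule \<Omega>_cases)
        thus ?thesis using elim by (simp add: glue_eq q_def c_def)
      qed
    qed
    thus ?case
      unfolding c_def[symmetric] eq using rs r by (simp add: dist_norm l2_norm_nonneg)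
  qed
qed

text \<open>The boundary condition transports a bump leaving the interval \<open>j\<close> at its left endpoint to the
  right endpoints of all intervals, with the weights given by column \<open>j\<close> of \<open>B\<close>.\<close>

lemma exp_group_bump:
  assumes U: "is_exp_group \<mu> (D_op \<alpha> \<beta> B) U"
    and b: "bump c d \<phi> \<phi>'" and cd: "\<alpha> j < c" "d < \<beta> j"
    and t: "0 \<le> t" "\<And>k. t \<le> \<beta> k - \<alpha> k"
  shows "U t (cls \<mu> (glue (\<lambda>k x. if k = j then \<phi> x else 0))) =
    cls \<mu> (glue (\<lambda>k x. (if k = j then \<phi> (x + t) else 0) + B $ k $ j * \<phi> (x + (t - \<beta> k + \<alpha> j))))"
proof -
  \<comment> \<open>Candidate solution along characteristics. The first term is the bump moving
    left. The second is fixed by the boundary condition: at \<open>x = \<beta> k\<close> it equals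
    \<open>B $ k $ j\<close> times \<open>\<phi> (\<alpha> j + s)\<close>, the value leaving at
    \<open>\<alpha> j\<close>.\<close>
  define g where "g s k x = (if k = j then \<phi> (x + s) else 0) + B $ k $ j * \<phi> (x + (s - \<beta> k + \<alpha> j))" for s k x
  define g' where "g' s k x = (if k = j then \<phi>' (x + s) else 0) + B $ k $ j * \<phi>' (x + (s - \<beta> k + \<alpha> j))" for s k x
  have gd: "(g s k has_vector_derivative g' s k x) (at x)" for s k x
    unfolding g_def[abs_def] g'_def
    by (cases "k = j") (auto intro!: derivative_eq_intros bump_shift_has_vector_derivative[OF b])
  have gc: "continuous_on UNIV (g s k)" for s k
    using gd by (auto simp: continuous_on_eq_continuous_at intro: has_vector_derivative_continuous)
  have shc: "continuous_on UNIV (\<lambda>x. \<phi>' (x + s))" for s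
    by (rule continuous_on_compose2[OF bump_continuous(2)[OF b]]) (auto intro!: continuous_intros)
  have gc': "continuous_on UNIV (g' s k)" for s k
    unfolding g'_def[abs_def] by (cases "k = j") (auto intro!: continuous_intros shc)
  have out: "\<phi> x = 0" if "x \<notin> {c<..<d}" for x using bump_outside[OF b that] by simp
  have main: "cls \<mu> (glue (g t)) = U t (cls \<mu> (glue (g 0)))"
  proof (cases "c < d")
    case False
    hence "\<phi> x = 0" for x using out by auto
    hence gz: "g s = (\<lambda>k x. 0)" for s by (auto simp: g_def fun_eq_iff)
    have z: "glue (g s) = (\<lambda>x. 0)" for s by (auto simp: gz glue_def fun_eq_iff)
    have uo: "unitary_operator \<mu> (U t)"
      using U by (simp add: is_exp_group_def continuous_unitary_group_def)
    have c0: "cls \<mu> (\<lambda>x. 0) \<in> L2 \<mu>" by (intro cls_in_L2 L2_fun_zero)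
    have "l2_scale \<mu> 0 (cls \<mu> (\<lambda>x. 0)) = cls \<mu> (\<lambda>x. 0)"
      by (simp add: l2_scale_cls L2_fun_zero)
    hence "U t (cls \<mu> (\<lambda>x. 0)) = l2_scale \<mu> 0 (U t (cls \<mu> (\<lambda>x. 0)))"
      using uo c0 unfolding unitary_operator_def by metis
    also have "\<dots> = cls \<mu> (\<lambda>x. 0)"
      by (simp add: l2_scale_def)
    finally show ?thesis by (simp add: z)
  next
    case True
    show ?thesis
    \<comment> \<open>Lower limit: going backwards, the bump would meet \<open>\<beta> j\<close> at
      time \<open>d - \<beta> j\<close>. Upper limit: before time
      \<open>t + (c - \<alpha> j)\<close> the reentered copies have not reached any
      \<open>\<alpha> k\<close>, because every length is at least \<open>t\<close>.\<close>
    proof (rule generator_cauchy_unique[where a = "d - \<beta> j" and b = "t + (c - \<alpha> j)"])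
      show "continuous_unitary_group \<mu> U" using U by (simp add: is_exp_group_def)
      show "0 \<in> {d - \<beta> j<..<t + (c - \<alpha> j)}" "t \<in> {d - \<beta> j<..<t + (c - \<alpha> j)}" using t cd by auto
    next
      fix s assume s: "s \<in> {d - \<beta> j<..<t + (c - \<alpha> j)}"
      show "(cls \<mu> (glue (g s)), cls \<mu> (glue (g' s))) \<in> generator \<mu> U"
      proof (rule generator_glue[OF U gd gc'])
        fix i
        \<comment> \<open>In this time window the reentered part vanishes at every
          \<open>\<alpha> k\<close> and the moving bump vanishes at \<open>\<beta> j\<close>; the
          boundary condition is thus left with column \<open>j\<close> only.\<close>
        have "g s k (\<alpha> k) = (if k = j then \<phi> (\<alpha> j + s) else 0)" for k
          using s t(2)[of k] out[of "\<alpha> k + (s - \<beta> k + \<alpha> j)"] by (simp add: g_def)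
        hence "(\<Sum>k\<in>UNIV. B $ i $ k * g s k (\<alpha> k)) = B $ i $ j * \<phi> (\<alpha> j + s)"
          by (simp add: if_distrib[of "\<lambda>x. _ * x"] cong: if_cong)
        also have "\<dots> = g s i (\<beta> i)"
          using s out[of "\<beta> j + s"] by (simp add: g_def add.commute)
        finally show "(\<Sum>k\<in>UNIV. B $ i $ k * g s k (\<alpha> k)) = g s i (\<beta> i)" .
      qed
      show "((\<lambda>h. l2_norm \<mu> (l2_diff \<mu> (l2_scale \<mu> (of_real (1 / h))
            (l2_diff \<mu> (cls \<mu> (glue (g (s + h)))) (cls \<mu> (glue (g s))))) (cls \<mu> (glue (g' s)))))
        \<longlongrightarrow> 0) (at 0)"
      proof (rule glue_quotient_tendsto[OF gc gc'])
        fix e :: real assume e: "e > 0"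
        \<comment> \<open>Each piece combines two translates of the bump with coefficients of
          modulus at most 1 and \<open>cmod (B $ k $ j)\<close>, so \<open>K\<close> bounds the
          amplification of the error for all pieces at once.\<close>
        define K where "K = 1 + (\<Sum>k\<in>UNIV. cmod (B $ k $ j))"
        have K: "K > 0" by (simp add: K_def sum_nonneg add_pos_nonneg)
        have BK: "1 + cmod (B $ k $ j) \<le> K" for k
          unfolding K_def by (intro add_left_mono member_le_sum) auto
        from K e have "e / K > 0" by simp
        from bump_uniform_quotient[OF b this]
        show "\<forall>\<^sub>F h in at 0. \<forall>k x. cmod (of_real (1 / h) * (g (s + h) k x - g s k x) - g' s k x) \<le> e"
        proof eventually_elim
          case (elim h)
          define q where "q x = of_real (1 / h) * (\<phi> (x + h) - \<phi> x) - \<phi>' x" for x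
          have q: "cmod (q x) \<le> e / K" for x using elim by (simp add: q_def)
          show ?case
          proof (intro allI)
            fix k x
            have eq: "of_real (1 / h) * (g (s + h) k x - g s k x) - g' s k x
              = (if k = j then q (x + s) else 0) + B $ k $ j * q (x + (s - \<beta> k + \<alpha> j))"
              by (simp add: g_def g'_def q_def algebra_simps)
            have "cmod (of_real (1 / h) * (g (s + h) k x - g s k x) - g' s k x)
              \<le> cmod (if k = j then q (x + s) else 0) + cmod (B $ k $ j) * cmod (q (x + (s - \<beta> k + \<alpha> j)))"
              unfolding eq using norm_triangle_ineq by (metis norm_mult)
            also have "\<dots> \<le> e / K + cmod (B $ k $ j) * (e / K)"
              using K e q by (intro add_mono mult_left_mono) auto
            also have "\<dots> = (1 + cmod (B $ k $ j)) * (e / K)" by (simp only: distrib_right mult_1_left)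
            also have "\<dots> \<le> K * (e / K)" using BK K e by (intro mult_right_mono) auto
            also have "\<dots> = e" using K by simp
            finally show "cmod (of_real (1 / h) * (g (s + h) k x - g s k x) - g' s k x) \<le> e" .
          qed
        qed
      qed
    qed
  qed
  have "cls \<mu> (glue (g 0)) = cls \<mu> (glue (\<lambda>k x. if k = j then \<phi> x else 0))"
  proof (rule cls_cong(2)[OF glue_L2[OF gc]])
    show "glue (\<lambda>k x. if k = j then \<phi> x else 0) \<in> borel_measurable \<mu>"
    proof (intro glue_measurable(2) continuous_measurable_lebesgue)
      show "continuous_on UNIV (\<lambda>x. if k = j then \<phi> x else 0)" for k
        using bump_continuous(1)[OF b] by (cases "k = j") simp_all
    qed
    fix x assume "x \<in> \<Omega>"
    then obtain k where k: "x \<in> I k" by (rule \<Omega>_cases)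
    \<comment> \<open>Nothing has reentered at time 0: points of \<open>I k\<close> lie left of
      \<open>\<beta> k\<close>, so the argument lies left of \<open>\<alpha> j < c\<close>.\<close>
    have "\<phi> (x + (0 - \<beta> k + \<alpha> j)) = 0"
      using k cd by (intro out) (auto simp: I_def)
    thus "glue (g 0) x = glue (\<lambda>k x. if k = j then \<phi> x else 0) x"
      using k by (simp add: glue_eq g_def)
  qed
  with main show ?thesis by (simp add: g_def[abs_def])
qed

end

section \<open>The fundamental lemma for smooth bumps\<close>

text \<open>Squaring smooths the corner of \<open>max 0 y\<close>: at the origin the difference
  quotient is bounded by \<open>\<bar>h\<bar>\<close>. This makes the base function of the bumps
  continuously differentiable.\<close>

lemma has_real_derivative_max0_square:
  "((\<lambda>y::real. (max 0 y)\<^sup>2) has_real_derivative 2 * max 0 y) (at y)"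
proof (cases y "0::real" rule: linorder_cases)
  case less
  have "((\<lambda>y::real. 0) has_real_derivative 0) (at y)" by simp
  hence "((\<lambda>y::real. (max 0 y)\<^sup>2) has_real_derivative 0) (at y)"
    by (rule has_field_derivative_transform_within_open[where S = "{..<0}"]) (use less in auto)
  thus ?thesis using less by simp
next
  case greater
  have "((\<lambda>y::real. y\<^sup>2) has_real_derivative 2 * y) (at y)"
    by (auto intro!: derivative_eq_intros)
  hence "((\<lambda>y::real. (max 0 y)\<^sup>2) has_real_derivative 2 * y) (at y)"
    by (rule has_field_derivative_transform_within_open[where S = "{0<..}"]) (use greater in auto)
  thus ?thesis using greater by simp
next
  case equal
  have "((\<lambda>h::real. (max 0 h)\<^sup>2 / h) \<longlongrightarrow> 0) (at 0)"
  proof (rule Lim_null_comparison)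
    show "\<forall>\<^sub>F h in at 0. norm ((max 0 h)\<^sup>2 / h) \<le> \<bar>h::real\<bar>"
      by (intro always_eventually) (auto simp: max_def power2_eq_square)
    show "((\<lambda>h::real. \<bar>h\<bar>) \<longlongrightarrow> 0) (at 0)"
      by (rule tendsto_rabs_zero) simp
  qed
  thus ?thesis using equal by (simp add: DERIV_def)
qed

text \<open>\<open>n \<psi> / (1 + n \<psi>)\<close> is a continuously differentiable approximation of the indicator function of
  \<open>{\<psi> > 0} = (c, d)\<close>.\<close>

definition bump_base :: "real \<Rightarrow> real \<Rightarrow> real \<Rightarrow> real" where
  "bump_base c d x = (if c < d then (max 0 ((x - c) * (d - x)))\<^sup>2 else 0)"

definition bump_fun :: "real \<Rightarrow> real \<Rightarrow> nat \<Rightarrow> real \<Rightarrow> real" where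
  "bump_fun c d n x = real n * bump_base c d x / (1 + real n * bump_base c d x)"

lemma bump_base_nonneg: "bump_base c d x \<ge> 0"
  by (simp add: bump_base_def)

lemma bump_base_pos_iff: "bump_base c d x > 0 \<longleftrightarrow> x \<in> {c<..<d}"
proof -
  have "(x - c) * (d - x) > 0 \<longleftrightarrow> x \<in> {c<..<d}" if "c < d"
    using that by (auto simp: zero_less_mult_iff)
  thus ?thesis by (auto simp: bump_base_def max_def)
qed

lemma bump_base_zero: "x \<notin> {c<..<d} \<Longrightarrow> bump_base c d x = 0"
  using bump_base_pos_iff[of c d x] bump_base_nonneg[of c d x] by linarith

lemma bump_fun_bounds: "0 \<le> bump_fun c d n x" "bump_fun c d n x \<le> 1"
  using bump_base_nonneg[of c d x] unfolding bump_fun_def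
  by (auto intro!: divide_nonneg_nonneg add_nonneg_nonneg mult_nonneg_nonneg simp: divide_le_eq_1 add_pos_nonneg)

lemma bump_fun_tendsto: "(\<lambda>n. bump_fun c d n x) \<longlonglongrightarrow> indicator {c<..<d} x"
proof (cases "x \<in> {c<..<d}")
  case True
  hence p: "bump_base c d x > 0" by (simp add: bump_base_pos_iff)
  have "filterlim (\<lambda>n. 1 + real n * bump_base c d x) at_top sequentially"
    using p by (intro filterlim_tendsto_add_at_top[OF tendsto_const]
        filterlim_at_top_mult_tendsto_pos[OF tendsto_const] filterlim_real_sequentially)
  hence "(\<lambda>n. 1 - inverse (1 + real n * bump_base c d x)) \<longlonglongrightarrow> 1 - 0"
    by (intro tendsto_diff tendsto_const tendsto_inverse_0_at_top)
  moreover have "1 - inverse (1 + real n * bump_base c d x) = bump_fun c d n x" for n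
  proof -
    have "1 + real n * bump_base c d x > 0" using p by (simp add: add_pos_nonneg)
    thus ?thesis by (simp add: bump_fun_def field_simps)
  qed
  ultimately show ?thesis using True by simp
qed (simp add: bump_fun_def bump_base_zero)

lemma bump_bump_fun: "\<exists>\<phi>'. bump c d (\<lambda>x. of_real (bump_fun c d n x)) \<phi>'"
proof -
  define f where "f = bump_base c d"
  define f' where "f' x = (if c < d then 2 * max 0 ((x - c) * (d - x)) * (c + d - 2 * x) else 0)" for x
  have fd: "(f has_real_derivative f' x) (at x)" for x
  proof (cases "c < d")
    case True
    have "((\<lambda>x. (x - c) * (d - x)) has_real_derivative (c + d - 2 * x)) (at x)"
      by (auto intro!: derivative_eq_intros)
    from DERIV_chain2[OF has_real_derivative_max0_square this] show ?thesis
      using True unfolding f_def bump_base_def[abs_def] f'_def by simp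
  qed (simp add: f_def bump_base_def[abs_def] f'_def)
  have f0: "f x \<ge> 0" for x by (simp add: f_def bump_base_nonneg)
  have p: "1 + real n * f x > 0" for x using f0[of x] by (simp add: add_pos_nonneg)
  define r where "r x = real n * f' x / (1 + real n * f x)\<^sup>2" for x
  have rd: "(bump_fun c d n has_real_derivative r x) (at x)" for x
    unfolding bump_fun_def[abs_def] f_def[symmetric] r_def using p[of x]
    by (auto intro!: derivative_eq_intros fd simp: power2_eq_square field_simps)
  have fc: "continuous_on UNIV f"
    using fd by (intro DERIV_continuous_on) (auto intro: has_field_derivative_at_within)
  have f'c: "continuous_on UNIV f'"
    unfolding f'_def[abs_def] by (cases "c < d") (auto intro!: continuous_intros)
  have rc: "continuous_on UNIV r"
    unfolding r_def[abs_def] using p by (intro continuous_intros fc f'c) (auto simp: less_imp_neq[symmetric])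
  have "bump c d (\<lambda>x. of_real (bump_fun c d n x)) (\<lambda>x. of_real (r x))"
    unfolding bump_def
  proof (intro conjI allI impI)
    show "((\<lambda>x. complex_of_real (bump_fun c d n x)) has_vector_derivative complex_of_real (r x)) (at x)" for x
      using rd[of x] by (intro has_vector_derivative_of_real) (simp add: has_real_derivative_iff_has_vector_derivative)
    show "continuous_on UNIV (\<lambda>x. complex_of_real (r x))"
      by (intro continuous_intros rc)
    fix x assume x: "x \<notin> {c<..<d}"
    show "complex_of_real (bump_fun c d n x) = 0"
      using x by (simp add: bump_fun_def bump_base_zero)
    have "f' x = 0"
    proof (cases "c < d")
      case True
      hence "(x - c) * (d - x) \<le> 0" using x by (auto simp: mult_le_0_iff)
      thus ?thesis by (simp add: f'_def)
    qed (simp add: f'_def)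
    thus "complex_of_real (r x) = 0" by (simp add: r_def)
  qed
  thus ?thesis by blast
qed

text \<open>The bumps \<open>bump_fun c d n\<close> take values in \<open>[0,1]\<close> and converge
  pointwise to the indicator function of \<open>(c, d)\<close>, so dominated convergence with
  majorant \<open>norm (F x)\<close> applies.\<close>

lemma bump_orthogonal_set_integral_zero:
  fixes F :: "real \<Rightarrow> complex"
  assumes F: "integrable lebesgue F"
    and orth: "\<And>c d \<phi> \<phi>'. bump c d \<phi> \<phi>' \<Longrightarrow> a < c \<Longrightarrow> d < b \<Longrightarrow> (LINT x|lebesgue. \<phi> x * F x) = 0"
    and cd: "a < c" "d < b"
  shows "(LINT x|lebesgue. indicator {c<..<d} x *\<^sub>R F x) = 0"
proof -
  have [measurable]: "F \<in> borel_measurable lebesgue" using F by simp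
  have bm: "bump_fun c d n \<in> borel_measurable lebesgue" for n
  proof -
    have "bump_fun c d n \<in> borel_measurable borel"
      unfolding bump_fun_def[abs_def] bump_base_def[abs_def] by measurable
    thus ?thesis by (intro measurable_completion) simp
  qed
  have "(\<lambda>n. LINT x|lebesgue. bump_fun c d n x *\<^sub>R F x) \<longlonglongrightarrow> (LINT x|lebesgue. indicator {c<..<d} x *\<^sub>R F x)"
  proof (rule integral_dominated_convergence[where w = "\<lambda>x. norm (F x)"])
    show "AE x in lebesgue. (\<lambda>n. bump_fun c d n x *\<^sub>R F x) \<longlonglongrightarrow> indicator {c<..<d} x *\<^sub>R F x"
      by (intro always_eventually allI tendsto_scaleR bump_fun_tendsto tendsto_const)
    show "AE x in lebesgue. norm (bump_fun c d n x *\<^sub>R F x) \<le> norm (F x)" for n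
      using bump_fun_bounds[of c d n] by (intro always_eventually allI) (auto intro!: mult_left_le_one_le)
    show "(\<lambda>x. bump_fun c d n x *\<^sub>R F x) \<in> borel_measurable lebesgue" for n
      using bm by measurable
    show "(\<lambda>x. indicator {c<..<d} x *\<^sub>R F x) \<in> borel_measurable lebesgue"
      by (intro borel_measurable_integrable integrable_mult_indicator F) simp
  qed (use F in auto)
  moreover have "(LINT x|lebesgue. bump_fun c d n x *\<^sub>R F x) = 0" for n
  proof -
    obtain \<phi>' where "bump c d (\<lambda>x. of_real (bump_fun c d n x)) \<phi>'"
      using bump_bump_fun by blast
    from orth[OF this cd] show ?thesis by (simp add: scaleR_conv_of_real)
  qed
  ultimately show ?thesis using LIMSEQ_unique[OF _ tendsto_const] by fastforce
qed

text \<open>An integrable function on a finite measure space vanishes almost everywhere once its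
  integral over every measurable set is zero. The class of such sets is enlarged from intervals
  compactly inside \<open>(a, b)\<close> to all intervals, to Borel sets and to Lebesgue
  sets.\<close>

lemma bump_orthogonal_AE_zero:
  fixes F :: "real \<Rightarrow> complex"
  assumes F: "integrable lebesgue F"
    and orth: "\<And>c d \<phi> \<phi>'. bump c d \<phi> \<phi>' \<Longrightarrow> a < c \<Longrightarrow> d < b \<Longrightarrow> (LINT x|lebesgue. \<phi> x * F x) = 0"
    and out: "\<And>x. x \<notin> {a<..<b} \<Longrightarrow> F x = 0"
  shows "AE x in lebesgue. F x = 0"
proof -
  have [measurable]: "F \<in> borel_measurable lebesgue" using F by simp
  have intS: "integrable lebesgue (\<lambda>x. indicator A x *\<^sub>R F x)" if "A \<in> sets lebesgue" for A
    using that F by (rule integrable_mult_indicator)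
  have box: "(LINT x|lebesgue. indicator {c<..<d} x *\<^sub>R F x) = 0" for c d
  proof -
    \<comment> \<open>The interval is trimmed to keep distance \<open>1/(n+1)\<close> from
      \<open>a\<close> and \<open>b\<close>, as the orthogonality hypothesis requires. At each point
      of \<open>(a, b)\<close> trimming is eventually without effect, and elsewhere \<open>F\<close>
      is zero.\<close>
    define S where "S n = {max c (a + 1 / real (Suc n))<..<min d (b - 1 / real (Suc n))}" for n
    have "(\<lambda>n. LINT x|lebesgue. indicator (S n) x *\<^sub>R F x) \<longlonglongrightarrow> (LINT x|lebesgue. indicator {c<..<d} x *\<^sub>R F x)"
    proof (rule integral_dominated_convergence[where w = "\<lambda>x. norm (F x)"])
      have "(\<lambda>n. indicator (S n) x *\<^sub>R F x) \<longlonglongrightarrow> indicator {c<..<d} x *\<^sub>R F x" for x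
      proof (cases "x \<in> {a<..<b}")
        case True
        have l1: "(\<lambda>n. 1 / real (Suc n)) \<longlonglongrightarrow> 0"
          using LIMSEQ_inverse_real_of_nat by (simp add: inverse_eq_divide)
        have "\<forall>\<^sub>F n in sequentially. 1 / real (Suc n) < x - a"
          by (rule order_tendstoD(2)[OF l1]) (use True in simp)
        moreover have "\<forall>\<^sub>F n in sequentially. 1 / real (Suc n) < b - x"
          by (rule order_tendstoD(2)[OF l1]) (use True in simp)
        ultimately have "\<forall>\<^sub>F n in sequentially. indicator {c<..<d} x *\<^sub>R F x = indicator (S n) x *\<^sub>R F x"
        proof eventually_elim
          case (elim n)
          hence "x \<in> S n \<longleftrightarrow> x \<in> {c<..<d}" unfolding S_def by auto
          thus ?case by (simp add: indicator_def)
        qed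
        from tendsto_cong[OF this] show ?thesis using tendsto_const by (metis (no_types))
      qed (simp add: out)
      thus "AE x in lebesgue. (\<lambda>n. indicator (S n) x *\<^sub>R F x) \<longlonglongrightarrow> indicator {c<..<d} x *\<^sub>R F x"
        by simp
      show "(\<lambda>x. indicator (S n) x *\<^sub>R F x) \<in> borel_measurable lebesgue" for n
        by (intro borel_measurable_integrable intS) (simp add: S_def)
      show "(\<lambda>x. indicator {c<..<d} x *\<^sub>R F x) \<in> borel_measurable lebesgue"
        by (intro borel_measurable_integrable intS) simp
      show "AE x in lebesgue. norm (indicator (S n) x *\<^sub>R F x) \<le> norm (F x)" for n
        by (simp add: indicator_def)
    qed (use F in auto)
    moreover have "(LINT x|lebesgue. indicator (S n) x *\<^sub>R F x) = 0" for n
      unfolding S_def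
      by (rule bump_orthogonal_set_integral_zero[OF F orth])
        (auto simp: less_max_iff_disj min_less_iff_disj simp del: of_nat_Suc)
    ultimately show ?thesis using LIMSEQ_unique[OF _ tendsto_const] by fastforce
  qed
  \<comment> \<open>Needed for complements in the Dynkin argument, which runs over the
    intersection-stable family of open intervals.\<close>
  have all: "(LINT x|lebesgue. F x) = 0"
  proof -
    have "(LINT x|lebesgue. F x) = (LINT x|lebesgue. indicator {a<..<b} x *\<^sub>R F x)"
      by (intro Bochner_Integration.integral_cong) (auto simp: indicator_def out)
    thus ?thesis using box by simp
  qed
  have sb: "sets (borel :: real measure) = sigma_sets UNIV (range (\<lambda>(a, b). box a b))"
    by (subst borel_eq_box) (rule sets_measure_of, auto)
  have borel: "(LINT x|lebesgue. indicator A x *\<^sub>R F x) = 0" if "A \<in> sets borel" for A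
  proof -
    have "Int_stable (range (\<lambda>(a, b). box a b :: real set))"
      by (auto simp: Int_stable_def box_Int_box)
    moreover have "range (\<lambda>(a, b). box a b :: real set) \<subseteq> Pow UNIV" by auto
    moreover have "A \<in> sigma_sets UNIV (range (\<lambda>(a, b). box a b))"
      using that unfolding sb .
    ultimately show ?thesis
    proof (induction rule: sigma_sets_induct_disjoint)
      case (basic A)
      thus ?case using box by auto
    next
      case empty
      show ?case by simp
    next
      case (compl A)
      have "A \<in> sets borel" using compl(1) unfolding sb .
      hence [simp]: "A \<in> sets lebesgue" by simp
      have "(LINT x|lebesgue. indicator (UNIV - A) x *\<^sub>R F x) = (LINT x|lebesgue. F x - indicator A x *\<^sub>R F x)"
        by (intro Bochner_Integration.integral_cong) (auto simp: indicator_def)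
      also have "\<dots> = 0" using compl by (simp add: Bochner_Integration.integral_diff[OF F intS] all)
      finally show ?case .
    next
      case (union A)
      hence "A i \<in> sigma_sets UNIV (range (\<lambda>(a, b). box a b))" for i by blast
      hence "A i \<in> sets borel" for i unfolding sb .
      hence [simp]: "A i \<in> sets lebesgue" for i by simp
      have "(LINT x:(\<Union>i. A i)|lebesgue. F x) = (\<Sum>i. (LINT x:(A i)|lebesgue. F x))"
      proof (rule lebesgue_integral_countable_add)
        show "set_integrable lebesgue (\<Union>i. A i) F"
          unfolding set_integrable_def by (intro intS sets.countable_UN) auto
        show "i \<noteq> j \<Longrightarrow> A i \<inter> A j = {}" for i j
          using union(1) by (auto simp: disjoint_family_on_def)
      qed simp
      thus ?case using union by (simp add: set_lebesgue_integral_def)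
    qed
  qed
  have leb: "(LINT x|lebesgue. indicator A x *\<^sub>R F x) = 0" if AL: "A \<in> sets lebesgue" for A
  proof -
    \<comment> \<open>A Lebesgue set is a Borel set up to a subset of a Borel null set, which does
      not affect the integral.\<close>
    obtain S N N' where A: "A = S \<union> N" "N \<subseteq> N'" "N' \<in> null_sets lborel" "S \<in> sets lborel"
      using AL by (rule sets_completionE)
    have "AE x in lebesgue. x \<notin> N'"
      by (rule AE_not_in) (rule null_sets_completionI[OF A(3)])
    hence "AE x in lebesgue. indicator A x *\<^sub>R F x = indicator S x *\<^sub>R F x"
      by eventually_elim (use A in \<open>auto simp: indicator_def\<close>)
    hence "(LINT x|lebesgue. indicator A x *\<^sub>R F x) = (LINT x|lebesgue. indicator S x *\<^sub>R F x)"
      using AL A(4) by (intro integral_cong_AE borel_measurable_integrable intS) auto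
    thus ?thesis using borel A(4) by simp
  qed
  interpret fm: finite_measure "lebesgue_on {a<..<b}"
    by (rule finite_measure_lebesgue_on) auto
  have "AE x in lebesgue_on {a<..<b}. F x = 0"
  proof (rule fm.density_zero)
    show "integrable (lebesgue_on {a<..<b}) F"
      using intS[of "{a<..<b}"] by (simp add: integrable_restrict_space)
    show "set_lebesgue_integral (lebesgue_on {a<..<b}) A F = 0" if "A \<in> sets (lebesgue_on {a<..<b})" for A
    proof -
      have A: "A \<in> sets lebesgue" "A \<subseteq> {a<..<b}"
        using that by (auto simp: sets_restrict_space_iff)
      have "set_lebesgue_integral (lebesgue_on {a<..<b}) A F
        = (LINT x|lebesgue. indicator {a<..<b} x *\<^sub>R (indicator A x *\<^sub>R F x))"
        unfolding set_lebesgue_integral_def by (simp add: integral_restrict_space)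
      also have "\<dots> = (LINT x|lebesgue. indicator A x *\<^sub>R F x)"
        using A(2) by (intro Bochner_Integration.integral_cong) (auto simp: indicator_def)
      finally show ?thesis using leb[OF A(1)] by simp
    qed
  qed
  hence "AE x in lebesgue. x \<in> {a<..<b} \<longrightarrow> F x = 0"
    by (simp add: AE_restrict_space_iff)
  thus ?thesis by eventually_elim (use out in blast)
qed

section \<open>The unitary group for small negative times\<close>

text \<open>Write \<open>G\<close> as \<open>U t (U (-t) G)\<close> and cancel the unitary
  \<open>U t\<close> in the inner product.\<close>

lemma unitary_group_inner_swap:
  assumes U: "continuous_unitary_group M U" and FG: "F \<in> L2 M" "G \<in> L2 M"
  shows "l2_inner M (U t F) G = l2_inner M F (U (-t) G)"
proof -
  have UU: "unitary_operator M (U t)" for t using U by (simp add: continuous_unitary_group_def)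
  have "U (t + (-t)) G = U t (U (-t) G)" and "U 0 G = G"
    using U FG(2) unfolding continuous_unitary_group_def by blast+
  hence "U t (U (-t) G) = G" by simp
  thus ?thesis
    using unitary_operator_inner[OF UU FG(1) unitary_operator_closed[OF UU FG(2)], of t "-t"] by simp
qed

lemma bump_bounded:
  assumes "bump c d \<phi> \<phi>'"
  obtains C where "\<And>x. cmod (\<phi> x) \<le> C"
proof -
  have "compact (\<phi> ` {c..d})"
    using bump_continuous(1)[OF assms] by (intro compact_continuous_image) (auto elim: continuous_on_subset)
  hence "bounded (\<phi> ` {c..d})" by (rule compact_imp_bounded)
  then obtain C where C: "\<And>x. x \<in> {c..d} \<Longrightarrow> cmod (\<phi> x) \<le> C"
    unfolding bounded_iff by blast
  have "cmod (\<phi> x) \<le> \<bar>C\<bar>" for x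
  proof (cases "x \<in> {c..d}")
    case True
    thus ?thesis using C[of x] by linarith
  next
    case False
    hence "x \<notin> {c<..<d}" by auto
    thus ?thesis using bump_outside[OF assms] by simp
  qed
  thus ?thesis by (rule that)
qed

context intervals
begin

text \<open>Extension by zero to the line, so that integrals over \<open>\<Omega>\<close> become
  integrals over the line, where translation is a change of variables.\<close>

definition cut :: "(real \<Rightarrow> complex) \<Rightarrow> 'n \<Rightarrow> real \<Rightarrow> complex" where
  "cut f k x = (if x \<in> I k then f x else 0)"

text \<open>The value at \<open>y \<in> (\<alpha>\<^sub>j, \<beta>\<^sub>j)\<close> of \<open>U(-t) f\<close>: mass entering the interval \<open>j\<close> at \<open>\<alpha>\<^sub>j\<close> comes
  from the right endpoints of all intervals.\<close>

definition pull :: "complex^('n::{finite,linorder})^('n::{finite,linorder}) \<Rightarrow> real \<Rightarrow> (real \<Rightarrow> complex) \<Rightarrow> 'n \<Rightarrow> real \<Rightarrow> complex" where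
  "pull B t f j y = cut f j (y - t) + (\<Sum>k\<in>UNIV. cnj (B $ k $ j) * cut f k (y - (t - \<beta> k + \<alpha> j)))"

section \<open>Integrability and translation on the line\<close>

lemma L2_fun_integrable:
  assumes "f \<in> L2_fun \<mu>"
  shows "integrable \<mu> f"
proof -
  interpret finite_measure \<mu> by (rule finite_measure_mu)
  have "cmod (f x) \<le> 1 + (cmod (f x))\<^sup>2" for x
    using zero_le_power2[of "cmod (f x) - 1"] unfolding power2_diff by (simp add: field_simps) (use norm_ge_zero[of "f x"] in linarith)
  thus ?thesis
    using assms by (intro Bochner_Integration.integrable_bound[where f = "\<lambda>x. 1 + (cmod (f x))\<^sup>2" and g = f])
      (auto simp: L2_fun_def)
qed

lemma cut_integrable:
  assumes "f \<in> L2_fun \<mu>"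
  shows "integrable lebesgue (cut f k)"
proof -
  have "integrable lebesgue (\<lambda>x. indicator \<Omega> x *\<^sub>R f x)"
    using L2_fun_integrable[OF assms] unfolding \<mu>_def by (simp add: integrable_restrict_space)
  hence "integrable lebesgue (\<lambda>x. indicator (I k) x *\<^sub>R (indicator \<Omega> x *\<^sub>R f x))"
    by (rule integrable_mult_indicator[rotated]) simp
  also have "(\<lambda>x. indicator (I k) x *\<^sub>R (indicator \<Omega> x *\<^sub>R f x)) = cut f k"
    using I_subset[of k] by (auto simp: cut_def indicator_def fun_eq_iff)
  finally show ?thesis .
qed

lemma integrable_shift:
  "integrable lebesgue (u :: real \<Rightarrow> complex) \<Longrightarrow> integrable lebesgue (\<lambda>y. u (y - s))"
  using lebesgue_integrable_real_affine[of u 1 "-s"] by simp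

lemma pull_integrable:
  assumes "f \<in> L2_fun \<mu>"
  shows "integrable lebesgue (pull B t f j)"
  unfolding pull_def[abs_def]
  by (intro Bochner_Integration.integrable_add Bochner_Integration.integrable_sum integrable_mult_right
      integrable_shift cut_integrable assms)

lemma bump_mult_integrable:
  assumes b: "bump c d \<phi> \<phi>'" and u: "integrable lebesgue u"
  shows "integrable lebesgue (\<lambda>x. \<phi> x * u x)"
proof -
  obtain C where C: "\<And>x. cmod (\<phi> x) \<le> C" by (rule bump_bounded[OF b]) blast
  have [measurable]: "\<phi> \<in> borel_measurable lebesgue"
    by (rule continuous_measurable_lebesgue[OF bump_continuous(1)[OF b]])
  have [measurable]: "u \<in> borel_measurable lebesgue" using u by simp
  have "cmod (\<phi> x) * cmod (u x) \<le> \<bar>C\<bar> * cmod (u x)" for x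
    using C[of x] by (intro mult_right_mono) auto
  thus ?thesis
    using u by (intro Bochner_Integration.integrable_bound[where f = "\<lambda>x. C * cmod (u x)" and g = "\<lambda>x. \<phi> x * u x"])
      (auto simp: norm_mult abs_mult)
qed

lemma integral_shift:
  fixes \<phi> u :: "real \<Rightarrow> complex"
  shows
  "(LINT x|lebesgue. \<phi> (x + s) * u x) = (LINT y|lebesgue. \<phi> y * u (y - s))"
  using lebesgue_integral_real_affine[of 1 "\<lambda>y. \<phi> y * u (y - s)" s] by (simp add: add.commute)

text \<open>The restriction to the intervals is carried by \<open>f\<close>. The pieces of
  \<open>g\<close> remain functions on the whole line, so their translations can later be moved over
  to \<open>f\<close>.\<close>

lemma integral_glue:
  assumes "\<And>k. integrable lebesgue (\<lambda>x. g k x * cnj (cut f k x))"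
  shows "(LINT x|\<mu>. glue g x * cnj (f x)) = (\<Sum>k\<in>UNIV. LINT x|lebesgue. g k x * cnj (cut f k x))"
proof -
  have "indicator \<Omega> x *\<^sub>R (glue g x * cnj (f x)) = (\<Sum>k\<in>UNIV. g k x * cnj (cut f k x))" for x
  proof (cases "x \<in> \<Omega>")
    case True
    thus ?thesis by (simp add: glue_def sum_distrib_right cut_def) (intro sum.cong, auto)
  next
    case False
    hence "x \<notin> I k" for k using I_subset by blast
    thus ?thesis using False by (simp add: cut_def)
  qed
  thus ?thesis
    using assms unfolding \<mu>_def by (simp add: integral_restrict_space Bochner_Integration.integral_sum)
qed

text \<open>Testing \<open>U (-t) f\<close> against a bump in the interval \<open>j\<close> is the
  same as testing \<open>f\<close> against \<open>U t\<close> of the bump, which is known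
  explicitly; translating back yields \<open>pull\<close>. For such test functions nothing about
  \<open>f\<close> beyond square integrability enters.\<close>

lemma exp_group_weak:
  assumes U: "is_exp_group \<mu> (D_op \<alpha> \<beta> B) U"
    and t: "0 \<le> t" "\<And>k. t \<le> \<beta> k - \<alpha> k" and f: "f \<in> L2_fun \<mu>"
    and b: "bump c d \<phi> \<phi>'" and cd: "\<alpha> j < c" "d < \<beta> j"
  defines "r \<equiv> rep (U (-t) (cls \<mu> f))"
  shows "(LINT x|lebesgue. \<phi> x * cnj (cut r j x)) = (LINT x|lebesgue. \<phi> x * cnj (pull B t f j x))"
proof -
  have G: "continuous_unitary_group \<mu> U" using U by (simp add: is_exp_group_def)
  hence UU: "unitary_operator \<mu> (U t)" for t by (simp add: continuous_unitary_group_def)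
  have Uf: "U (-t) (cls \<mu> f) \<in> L2 \<mu>"
    by (intro unitary_operator_closed[OF UU] cls_in_L2 f)
  have r: "r \<in> L2_fun \<mu>" "cls \<mu> r = U (-t) (cls \<mu> f)"
    using rep_in_L2_fun[OF Uf] by (simp_all add: r_def)
  define p where "p k x = (if k = j then \<phi> x else 0)" for k x
  define g where "g k x = (if k = j then \<phi> (x + t) else 0) + B $ k $ j * \<phi> (x + (t - \<beta> k + \<alpha> j))" for k x
  have shc: "continuous_on UNIV (\<lambda>x. \<phi> (x + s))" for s
    by (rule continuous_on_compose2[OF bump_continuous(1)[OF b]]) (auto intro!: continuous_intros)
  have pL: "glue p \<in> L2_fun \<mu>"
  proof (rule glue_L2)
    show "continuous_on UNIV (p k)" for k
      unfolding p_def[abs_def] using bump_continuous(1)[OF b] by (cases "k = j") simp_all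
  qed
  have gL: "glue g \<in> L2_fun \<mu>"
  proof (rule glue_L2)
    show "continuous_on UNIV (g k)" for k
      unfolding g_def[abs_def] by (cases "k = j") (auto intro!: continuous_intros shc)
  qed
  have Up: "U t (cls \<mu> (glue p)) = cls \<mu> (glue g)"
    using exp_group_bump[OF U b cd t] by (simp add: p_def[abs_def] g_def[abs_def])
  have eI: "integrable lebesgue (\<lambda>x. cnj (cut h k x))" if "h \<in> L2_fun \<mu>" for h k
    using cut_integrable[OF that] by simp
  have bI: "integrable lebesgue (\<lambda>x. \<phi> (x + s) * cnj (cut f k x))" for s k
  proof -
    have "integrable lebesgue (\<lambda>y. \<phi> y * cnj (cut f k (y - s)))"
      by (intro bump_mult_integrable[OF b] integrable_shift[of "\<lambda>x. cnj (cut f k x)"] eI f)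
    from integrable_shift[OF this, of "-s"] show ?thesis by simp
  qed
  have "(LINT x|lebesgue. \<phi> x * cnj (cut r j x)) = (\<Sum>k\<in>UNIV. LINT x|lebesgue. p k x * cnj (cut r k x))"
    by (simp add: p_def if_distrib[of "\<lambda>z. z * _"] if_distrib[of "integral\<^sup>L lebesgue"] cong: if_cong)
      (subst sum.cong[OF refl, of _ _ "\<lambda>k. if k = j then LINT x|lebesgue. \<phi> x * cnj (cut r k x) else 0"], auto)
  also have "\<dots> = (LINT x|\<mu>. glue p x * cnj (r x))"
  proof (rule integral_glue[symmetric])
    show "integrable lebesgue (\<lambda>x. p k x * cnj (cut r k x))" for k
      using bump_mult_integrable[OF b eI[OF r(1)]] by (cases "k = j") (simp_all add: p_def)
  qed
  also have "\<dots> = l2_inner \<mu> (cls \<mu> (glue p)) (U (-t) (cls \<mu> f))"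
    unfolding r(2)[symmetric] by (rule l2_inner_cls[OF pL r(1), symmetric])
  also have "\<dots> = l2_inner \<mu> (cls \<mu> (glue g)) (cls \<mu> f)"
    using unitary_group_inner_swap[OF G cls_in_L2[OF pL] cls_in_L2[OF f], of t] Up by simp
  also have "\<dots> = (LINT x|\<mu>. glue g x * cnj (f x))"
    by (rule l2_inner_cls[OF gL f])
  also have "\<dots> = (\<Sum>k\<in>UNIV. LINT x|lebesgue. g k x * cnj (cut f k x))"
  proof (rule integral_glue)
    show "integrable lebesgue (\<lambda>x. g k x * cnj (cut f k x))" for k
      using bI by (cases "k = j") (simp_all add: g_def distrib_right mult.assoc)
  qed
  also have "\<dots> = (\<Sum>k\<in>UNIV. (if k = j then LINT x|lebesgue. \<phi> (x + t) * cnj (cut f j x) else 0) +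
      B $ k $ j * (LINT x|lebesgue. \<phi> (x + (t - \<beta> k + \<alpha> j)) * cnj (cut f k x)))"
  proof (rule sum.cong[OF refl])
    fix k :: 'n
    show "(LINT x|lebesgue. g k x * cnj (cut f k x)) =
      (if k = j then LINT x|lebesgue. \<phi> (x + t) * cnj (cut f j x) else 0) +
      B $ k $ j * (LINT x|lebesgue. \<phi> (x + (t - \<beta> k + \<alpha> j)) * cnj (cut f k x))"
      using bI by (cases "k = j") (simp_all add: g_def distrib_right mult.assoc)
  qed
  also have "\<dots> = (LINT x|lebesgue. \<phi> (x + t) * cnj (cut f j x)) +
      (\<Sum>k\<in>UNIV. B $ k $ j * (LINT x|lebesgue. \<phi> (x + (t - \<beta> k + \<alpha> j)) * cnj (cut f k x)))"
    by (simp add: sum.distrib)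
  \<comment> \<open>Every translation moves from the bump to \<open>f\<close>. The entries of
    \<open>B\<close> stay outside the conjugation, which is why \<open>pull\<close> contains their
    conjugates.\<close>
  also have "\<dots> = (LINT x|lebesgue. \<phi> x * cnj (cut f j (x - t))) +
      (\<Sum>k\<in>UNIV. B $ k $ j * (LINT x|lebesgue. \<phi> x * cnj (cut f k (x - (t - \<beta> k + \<alpha> j)))))"
    by (simp only: integral_shift[of \<phi> _ "\<lambda>x. cnj (cut f _ x)"])
  also have "\<dots> = (LINT x|lebesgue. \<phi> x * cnj (cut f j (x - t)) +
      (\<Sum>k\<in>UNIV. B $ k $ j * (\<phi> x * cnj (cut f k (x - (t - \<beta> k + \<alpha> j))))))"
  proof -
    have i: "integrable lebesgue (\<lambda>x. \<phi> x * cnj (cut f k (x - s)))" for k s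
      by (intro bump_mult_integrable[OF b] integrable_shift[of "\<lambda>x. cnj (cut f k x)"] eI f)
    show ?thesis
      by (subst Bochner_Integration.integral_add)
        (auto intro!: i Bochner_Integration.integrable_sum integrable_mult_right simp: Bochner_Integration.integral_sum i)
  qed
  also have "\<dots> = (LINT x|lebesgue. \<phi> x * cnj (pull B t f j x))"
    by (intro Bochner_Integration.integral_cong)
      (simp_all add: pull_def distrib_left sum_distrib_left mult.left_commute)
  finally show ?thesis .
qed

text \<open>The weak identity and the fundamental lemma give equality on each interval; finitely
  many null sets are then discarded together. Since \<open>rep\<close> picks some representative,
  equality almost everywhere is the meaningful form.\<close>

lemma exp_group_pull:
  assumes U: "is_exp_group \<mu> (D_op \<alpha> \<beta> B) U"
    and t: "0 \<le> t" "\<And>k. t \<le> \<beta> k - \<alpha> k" and f: "f \<in> L2_fun \<mu>"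
  shows "AE y in \<mu>. \<forall>j. y \<in> I j \<longrightarrow> rep (U (-t) (cls \<mu> f)) y = pull B t f j y"
proof -
  define r where "r = rep (U (-t) (cls \<mu> f))"
  have UU: "unitary_operator \<mu> (U t)" for t
    using U by (simp add: is_exp_group_def continuous_unitary_group_def)
  have r: "r \<in> L2_fun \<mu>"
    unfolding r_def by (intro rep_in_L2_fun unitary_operator_closed[OF UU] cls_in_L2 f)
  have j: "AE y in lebesgue. y \<in> I j \<longrightarrow> r y = pull B t f j y" for j
  proof -
    \<comment> \<open>The indicator is needed because \<open>pull B t f j\<close> need not vanish
      outside \<open>I j\<close>, whereas the fundamental lemma asks for a function that does. On
      bumps inside \<open>I j\<close> the truncation is invisible.\<close>
    define F where "F y = cnj (cut r j y) - indicator (I j) y *\<^sub>R cnj (pull B t f j y)" for y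
    have i1: "integrable lebesgue (\<lambda>y. cnj (cut r j y))" using cut_integrable[OF r] by simp
    have i2: "integrable lebesgue (\<lambda>y. cnj (pull B t f j y))" using pull_integrable[OF f] by simp
    have i3: "integrable lebesgue (\<lambda>y. indicator (I j) y *\<^sub>R cnj (pull B t f j y))"
      by (intro integrable_mult_indicator i2) simp
    have "AE y in lebesgue. F y = 0"
    proof (rule bump_orthogonal_AE_zero[where a = "\<alpha> j" and b = "\<beta> j"])
      show "integrable lebesgue F" unfolding F_def[abs_def] by (intro Bochner_Integration.integrable_diff i1 i3)
      show "F x = 0" if "x \<notin> {\<alpha> j<..<\<beta> j}" for x
        using that by (auto simp: F_def cut_def I_def)
      fix c d \<phi> \<phi>' assume b: "bump c d \<phi> \<phi>'" and cd: "\<alpha> j < c" "d < \<beta> j"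
      have "\<phi> x * F x = \<phi> x * cnj (cut r j x) - \<phi> x * cnj (pull B t f j x)" for x
      proof (cases "x \<in> I j")
        case False
        hence "x \<notin> {c<..<d}" using cd by (auto simp: I_def)
        thus ?thesis using bump_outside[OF b] by simp
      qed (simp add: F_def right_diff_distrib)
      hence "(LINT x|lebesgue. \<phi> x * F x) = (LINT x|lebesgue. \<phi> x * cnj (cut r j x) - \<phi> x * cnj (pull B t f j x))"
        by simp
      also have "\<dots> = (LINT x|lebesgue. \<phi> x * cnj (cut r j x)) - (LINT x|lebesgue. \<phi> x * cnj (pull B t f j x))"
        by (intro Bochner_Integration.integral_diff bump_mult_integrable[OF b] i1 i2)
      also have "\<dots> = 0"
        using exp_group_weak[OF U t f b cd] by (simp add: r_def)
      finally show "(LINT x|lebesgue. \<phi> x * F x) = 0" .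
    qed
    thus ?thesis
      by eventually_elim (auto simp: F_def cut_def complex_cnj_cancel_iff)
  qed
  have "AE y in lebesgue. \<forall>j. y \<in> I j \<longrightarrow> r y = pull B t f j y"
    using j by (simp add: AE_all_countable)
  hence "AE y in lebesgue. y \<in> \<Omega> \<longrightarrow> (\<forall>j. y \<in> I j \<longrightarrow> r y = pull B t f j y)"
    by eventually_elim simp
  hence "AE y in \<mu>. \<forall>j. y \<in> I j \<longrightarrow> r y = pull B t f j y"
    unfolding \<mu>_def by (simp add: AE_restrict_space_iff)
  thus ?thesis unfolding r_def .
qed

end

section \<open>Conjugation of multiplication operators\<close>

lemma L2_fun_mult_integrable:
  assumes f: "f \<in> L2_fun M" and g: "g \<in> L2_fun M"
  shows "integrable M (\<lambda>x. f x * cnj (g x))"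
proof (rule Bochner_Integration.integrable_bound)
  show "integrable M (\<lambda>x. (cmod (f x))\<^sup>2 + (cmod (g x))\<^sup>2)"
    using f g by (auto simp: L2_fun_def)
  have [measurable]: "f \<in> borel_measurable M" "g \<in> borel_measurable M"
    using f g by (auto simp: L2_fun_def)
  have [measurable]: "cnj \<in> borel_measurable borel"
    by (intro borel_measurable_continuous_onI continuous_intros)
  show "(\<lambda>x. f x * cnj (g x)) \<in> borel_measurable M" by measurable
  have "cmod a * cmod b \<le> (cmod a)\<^sup>2 + (cmod b)\<^sup>2" for a b
    using sum_squares_bound[of "cmod a" "cmod b"] zero_le_power2[of "cmod a"] zero_le_power2[of "cmod b"]
      mult_nonneg_nonneg[of "cmod a" "cmod b"] norm_ge_zero by linarith
  thus "AE x in M. norm (f x * cnj (g x)) \<le> norm ((cmod (f x))\<^sup>2 + (cmod (g x))\<^sup>2)"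
    by (simp add: norm_mult)
qed

text \<open>Test with \<open>F = H - K\<close>: the squared norm of the difference is zero.\<close>

lemma l2_inner_nondegenerate:
  assumes HK: "H \<in> L2 M" "K \<in> L2 M" and eq: "\<And>F. F \<in> L2 M \<Longrightarrow> l2_inner M F H = l2_inner M F K"
  shows "H = K"
proof -
  obtain h where h: "h \<in> L2_fun M" "H = cls M h" using HK(1) by (rule L2_obtain)
  obtain k where k: "k \<in> L2_fun M" "K = cls M k" using HK(2) by (rule L2_obtain)
  define d where "d x = h x - k x" for x
  have d: "d \<in> L2_fun M" unfolding d_def[abs_def] by (intro L2_fun_diff h k)
  have "l2_inner M (cls M d) (cls M d) = (LINT x|M. d x * cnj (h x) - d x * cnj (k x))"
    unfolding l2_inner_cls[OF d d]
    by (intro Bochner_Integration.integral_cong) (simp_all add: d_def right_diff_distrib)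
  also have "\<dots> = (LINT x|M. d x * cnj (h x)) - (LINT x|M. d x * cnj (k x))"
    by (intro Bochner_Integration.integral_diff L2_fun_mult_integrable d h k)
  also have "\<dots> = 0"
    using eq[OF cls_in_L2[OF d]] unfolding h(2) k(2) l2_inner_cls[OF d h(1)] l2_inner_cls[OF d k(1)] by simp
  finally have "l2_norm M (cls M d) = 0"
    unfolding l2_inner_self[OF cls_in_L2[OF d]] by simp
  hence "l2_norm M (l2_diff M H K) = 0"
    unfolding h(2) k(2) l2_diff_cls[OF h(1) k(1)] d_def[abs_def] .
  thus ?thesis by (rule l2_norm_diff_zero_imp_eq[OF HK])
qed

text \<open>Nondegeneracy makes the defining description unique. The equality is one of functions on
  all classes, hence the separate case outside \<open>L2 M\<close>, where both sides are
  \<open>undefined\<close>.\<close>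

lemma unitary_group_adjoint:
  assumes U: "continuous_unitary_group M U"
  shows "l2_adjoint M (U t) = U (-t)"
proof
  fix G
  have UU: "unitary_operator M (U t)" for t using U by (simp add: continuous_unitary_group_def)
  show "l2_adjoint M (U t) G = U (-t) G"
  proof (cases "G \<in> L2 M")
    case True
    have "(THE H. H \<in> L2 M \<and> (\<forall>F\<in>L2 M. l2_inner M (U t F) G = l2_inner M F H)) = U (-t) G"
    proof (rule the_equality)
      show "U (-t) G \<in> L2 M \<and> (\<forall>F\<in>L2 M. l2_inner M (U t F) G = l2_inner M F (U (-t) G))"
        using unitary_group_inner_swap[OF U _ True] unitary_operator_closed[OF UU True] by blast
      fix H assume "H \<in> L2 M \<and> (\<forall>F\<in>L2 M. l2_inner M (U t F) G = l2_inner M F H)"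
      thus "H = U (-t) G"
        using unitary_group_inner_swap[OF U _ True, of _ t]
        by (intro l2_inner_nondegenerate[OF _ unitary_operator_closed[OF UU True]]) auto
    qed
    thus ?thesis using True by (simp add: l2_adjoint_def)
  next
    case False
    have "U (-t) \<in> L2 M \<rightarrow>\<^sub>E L2 M" using UU by (simp add: unitary_operator_def)
    from PiE_arb[OF this False] show ?thesis using False by (simp add: l2_adjoint_def)
  qed
qed

text \<open>The conjugation from the Forelli condition with the adjoint replaced by
  \<open>U (-t)\<close>; in this form conjugations at different times compose by adding the
  times.\<close>

definition conj_op :: "'a measure \<Rightarrow> (real \<Rightarrow> 'a fclass \<Rightarrow> 'a fclass) \<Rightarrow> real \<Rightarrow> ('a fclass \<Rightarrow> 'a fclass) \<Rightarrow> 'a fclass \<Rightarrow> 'a fclass" where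
  "conj_op M U t S = compose (L2 M) (U t) (compose (L2 M) S (U (-t)))"

lemma forelli_iff_conj_op:
  "continuous_unitary_group M U \<Longrightarrow> forelli M (U t) \<longleftrightarrow> conj_op M U t ` mult_algebra M = mult_algebra M"
  by (simp add: forelli_def unitary_group_adjoint conj_op_def)

lemma unitary_group_closed: "continuous_unitary_group M U \<Longrightarrow> F \<in> L2 M \<Longrightarrow> U t F \<in> L2 M"
  by (rule unitary_operator_closed[of M "U t"]) (simp_all add: continuous_unitary_group_def)

lemma unitary_group_add: "continuous_unitary_group M U \<Longrightarrow> F \<in> L2 M \<Longrightarrow> U s (U t F) = U (s + t) F"
  by (simp add: continuous_unitary_group_def)

lemma unitary_group_zero: "continuous_unitary_group M U \<Longrightarrow> F \<in> L2 M \<Longrightarrow> U 0 F = F"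
  by (simp add: continuous_unitary_group_def)

lemma conj_op_add:
  assumes U: "continuous_unitary_group M U" and S: "S \<in> L2 M \<rightarrow>\<^sub>E L2 M"
  shows "conj_op M U s (conj_op M U t S) = conj_op M U (s + t) S"
proof
  fix F
  show "conj_op M U s (conj_op M U t S) F = conj_op M U (s + t) S F"
  proof (cases "F \<in> L2 M")
    case True
    have "S (U (- t) (U (- s) F)) \<in> L2 M"
      by (intro PiE_mem[OF S] unitary_group_closed[OF U] True)
    thus ?thesis
      using True by (simp add: conj_op_def compose_def unitary_group_closed[OF U] unitary_group_add[OF U] add.commute)
  qed (simp add: conj_op_def compose_def)
qed

lemma conj_op_zero:
  assumes U: "continuous_unitary_group M U" and S: "S \<in> L2 M \<rightarrow>\<^sub>E L2 M"
  shows "conj_op M U 0 S = S"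
proof
  fix F
  show "conj_op M U 0 S F = S F"
  proof (cases "F \<in> L2 M")
    case True
    thus ?thesis
      using PiE_mem[OF S True] by (simp add: conj_op_def compose_def unitary_group_zero[OF U])
  next
    case False
    thus ?thesis using PiE_arb[OF S False] by (simp add: conj_op_def compose_def)
  qed
qed

section \<open>Multiplication operators and their symbols\<close>

lemma Linf_mult_L2:
  assumes g: "g \<in> Linf_fun M" and f: "f \<in> L2_fun M"
  shows "(\<lambda>x. g x * f x) \<in> L2_fun M"
proof -
  obtain C where C: "AE x in M. cmod (g x) \<le> C" using g by (auto simp: Linf_fun_def)
  have [measurable]: "f \<in> borel_measurable M" "g \<in> borel_measurable M"
    using f g by (auto simp: L2_fun_def Linf_fun_def)
  have "integrable M (\<lambda>x. (cmod (g x * f x))\<^sup>2)"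
  proof (rule Bochner_Integration.integrable_bound)
    show "integrable M (\<lambda>x. C\<^sup>2 * (cmod (f x))\<^sup>2)" using f by (auto simp: L2_fun_def)
    show "AE x in M. norm ((cmod (g x * f x))\<^sup>2) \<le> norm (C\<^sup>2 * (cmod (f x))\<^sup>2)"
      using C by eventually_elim (auto simp: norm_mult power_mult_distrib intro!: mult_right_mono power_mono)
  qed measurable
  thus ?thesis by (simp add: L2_fun_def)
qed

lemma mult_op_cls:
  assumes g: "g \<in> Linf_fun M" and f: "f \<in> L2_fun M"
  shows "mult_op M g (cls M f) = cls M (\<lambda>x. g x * f x)"
proof -
  have "cls M (\<lambda>x. g x * rep (cls M f) x) = cls M (\<lambda>x. g x * f x)"
    using rep_cls[OF f] Linf_mult_L2[OF g] f
    by (subst cls_eq_iff) (auto elim: AE_mp)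
  thus ?thesis using cls_in_L2[OF f] by (simp add: mult_op_def)
qed

lemma mult_op_PiE:
  assumes "g \<in> Linf_fun M"
  shows "mult_op M g \<in> L2 M \<rightarrow>\<^sub>E L2 M"
  unfolding mult_op_def using Linf_mult_L2[OF assms] by (auto intro!: cls_in_L2 rep_in_L2_fun)

lemma mult_algebra_PiE: "S \<in> mult_algebra M \<Longrightarrow> S \<in> L2 M \<rightarrow>\<^sub>E L2 M"
  unfolding mult_algebra_def using mult_op_PiE by blast

lemma mult_op_cong:
  assumes g: "g \<in> Linf_fun M" and h: "h \<in> borel_measurable M" and gh: "AE x in M. g x = h x"
  shows "h \<in> Linf_fun M" "mult_op M g = mult_op M h"
proof -
  obtain C where C: "AE x in M. cmod (g x) \<le> C" using g by (auto simp: Linf_fun_def)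
  have "AE x in M. cmod (h x) \<le> C" using C gh by eventually_elim simp
  thus hL: "h \<in> Linf_fun M" using h by (auto simp: Linf_fun_def)
  show "mult_op M g = mult_op M h"
    unfolding mult_op_def
  proof (rule restrict_ext)
    fix F assume "F \<in> L2 M"
    hence r: "rep F \<in> L2_fun M" by (rule rep_in_L2_fun)
    show "cls M (\<lambda>x. g x * rep F x) = cls M (\<lambda>x. h x * rep F x)"
      using gh by (subst cls_eq_iff[OF Linf_mult_L2[OF g r] Linf_mult_L2[OF hL r]]) (auto elim: AE_mp)
  qed
qed

text \<open>A symbol bounded at every point stays bounded under translation and gluing, so no
  exceptional null sets have to be translated.\<close>

lemma Linf_bounded_representative:
  assumes g: "g \<in> Linf_fun M"
  obtains h C where "h \<in> Linf_fun M" "mult_op M h = mult_op M g" "\<And>x. cmod (h x) \<le> C" "C \<ge> 0"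
proof -
  obtain C where C: "AE x in M. cmod (g x) \<le> C" using g by (auto simp: Linf_fun_def)
  have [measurable]: "g \<in> borel_measurable M" using g by (auto simp: Linf_fun_def)
  define h where "h x = (if cmod (g x) \<le> C then g x else 0)" for x
  have h: "h \<in> borel_measurable M" unfolding h_def[abs_def] by measurable
  have "AE x in M. g x = h x" using C by eventually_elim (simp add: h_def)
  note c = mult_op_cong[OF g h this]
  show ?thesis
  proof (rule that)
    show "h \<in> Linf_fun M" "mult_op M h = mult_op M g" using c by simp_all
    show "cmod (h x) \<le> \<bar>C\<bar>" for x by (auto simp: h_def)
  qed simp
qed

text \<open>Together with \<open>conj_op_image_add\<close> this says that the times at which
  conjugation maps the multiplication algebra onto itself are closed under negation and
  addition.\<close>

lemma conj_op_image_neg: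
  assumes U: "continuous_unitary_group M U"
    and t: "conj_op M U t ` mult_algebra M = mult_algebra M"
  shows "conj_op M U (-t) ` mult_algebra M = mult_algebra M"
proof -
  have S: "conj_op M U (-t) (conj_op M U t S) = S" if "S \<in> mult_algebra M" for S
  proof -
    have "S \<in> L2 M \<rightarrow>\<^sub>E L2 M" using that by (rule mult_algebra_PiE)
    thus ?thesis using conj_op_add[OF U, of S "-t" t] conj_op_zero[OF U, of S] by simp
  qed
  have "conj_op M U (-t) ` mult_algebra M = conj_op M U (-t) ` (conj_op M U t ` mult_algebra M)"
    using t by simp
  also have "\<dots> = mult_algebra M"
    using S by (force simp: image_image)
  finally show ?thesis .
qed

lemma conj_op_image_add:
  assumes U: "continuous_unitary_group M U"
    and s: "conj_op M U s ` mult_algebra M = mult_algebra M"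
    and t: "conj_op M U t ` mult_algebra M = mult_algebra M"
  shows "conj_op M U (s + t) ` mult_algebra M = mult_algebra M"
proof -
  have S: "conj_op M U (s + t) S = conj_op M U s (conj_op M U t S)" if "S \<in> mult_algebra M" for S
    by (rule conj_op_add[OF U mult_algebra_PiE[OF that], symmetric])
  have "conj_op M U (s + t) ` mult_algebra M = conj_op M U s ` (conj_op M U t ` mult_algebra M)"
    unfolding image_image using S by (rule image_cong[OF refl])
  thus ?thesis using s t by simp
qed

text \<open>Those times form a subgroup of the real line, and a subgroup containing
  \<open>(-e, 0]\<close> is everything: each time is a multiple of a small one.\<close>

lemma group_forelli_if_small:
  assumes U: "continuous_unitary_group M U" and e: "e > 0"
    and small: "\<And>t. 0 \<le> t \<Longrightarrow> t < e \<Longrightarrow> conj_op M U (-t) ` mult_algebra M = mult_algebra M"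
  shows "group_forelli M U"
proof -
  have mult: "conj_op M U (real n * s) ` mult_algebra M = mult_algebra M"
    if s: "conj_op M U s ` mult_algebra M = mult_algebra M" for n s
  proof (induction n)
    case 0
    show ?case using small[of 0] e by simp
  next
    case (Suc n)
    show ?case using conj_op_image_add[OF U s Suc] by (simp add: algebra_simps)
  qed
  have neg: "conj_op M U (-t) ` mult_algebra M = mult_algebra M" if t: "t \<ge> 0" for t
  proof -
    \<comment> \<open>Enough pieces to make \<open>t / n\<close> smaller than \<open>e\<close>;
      since \<open>t / e\<close> is nonnegative, \<open>n\<close> is positive.\<close>
    obtain n where n: "t / e < real n" using reals_Archimedean2 by blast
    have "real n > 0" using n t e by (metis divide_nonneg_pos le_less_trans)
    hence "conj_op M U (- (t / real n)) ` mult_algebra M = mult_algebra M"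
      using n t e by (intro small) (auto simp: field_simps)
    from mult[OF this, of n] show ?thesis using \<open>real n > 0\<close> by simp
  qed
  have "conj_op M U t ` mult_algebra M = mult_algebra M" for t
  proof (cases "t \<ge> 0")
    case True
    thus ?thesis using conj_op_image_neg[OF U neg[OF True]] by simp
  next
    case False
    thus ?thesis using neg[of "-t"] by simp
  qed
  thus ?thesis using U by (simp add: group_forelli_def forelli_iff_conj_op)
qed

section \<open>Unitary matrices with one nonzero entry per column\<close>

lemma unitary_matrix_row:
  assumes "unitary_matrix B"
  shows "(\<Sum>j\<in>UNIV. (cmod (B $ i $ j))\<^sup>2) = 1"
proof -
  have "(B ** conj_transpose B) $ i $ i = 1"
    using assms by (simp add: unitary_matrix_def mat_def)
  hence "of_real (\<Sum>j\<in>UNIV. (cmod (B $ i $ j))\<^sup>2) = (1 :: complex)"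
    by (simp add: matrix_matrix_mult_def conj_transpose_def complex_norm_square[symmetric])
  thus ?thesis by (simp only: of_real_eq_1_iff)
qed

lemma unitary_matrix_column:
  assumes "unitary_matrix B"
  shows "(\<Sum>i\<in>UNIV. (cmod (B $ i $ j))\<^sup>2) = 1"
proof -
  have "(conj_transpose B ** B) $ j $ j = 1"
    using assms by (simp add: unitary_matrix_def mat_def)
  hence "of_real (\<Sum>i\<in>UNIV. (cmod (B $ i $ j))\<^sup>2) = (1 :: complex)"
    by (simp add: matrix_matrix_mult_def conj_transpose_def complex_norm_square[symmetric] mult.commute)
  thus ?thesis by (simp only: of_real_eq_1_iff)
qed

lemma unit_sum_other_zero:
  fixes a :: "'n::finite \<Rightarrow> complex"
  assumes "(\<Sum>k\<in>UNIV. (cmod (a k))\<^sup>2) = 1" "cmod (a i) = 1" "j \<noteq> i"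
  shows "a j = 0"
proof -
  have "(\<Sum>k\<in>UNIV. (cmod (a k))\<^sup>2) = (cmod (a i))\<^sup>2 + (\<Sum>k\<in>UNIV - {i}. (cmod (a k))\<^sup>2)"
    by (rule sum.remove) auto
  hence "(\<Sum>k\<in>UNIV - {i}. (cmod (a k))\<^sup>2) = 0" using assms by simp
  hence "(cmod (a j))\<^sup>2 = 0"
    using assms(3) by (subst (asm) sum_nonneg_eq_0_iff) auto
  thus ?thesis by simp
qed

text \<open>Columns have norm 1, so a single nonzero entry is unimodular and determines a row
  \<open>\<tau> j\<close>. Rows have norm 1 as well, so no row is used twice; on a finite index set
  \<open>\<tau>\<close> is then bijective. Its inverse is the required permutation, which assigns
  columns to rows.\<close>

lemma weighted_permutation_if_columns:
  fixes B :: "complex^'n^'n"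
  assumes B: "unitary_matrix B"
    and col: "\<And>i i' j. B $ i $ j \<noteq> 0 \<Longrightarrow> B $ i' $ j \<noteq> 0 \<Longrightarrow> i = i'"
  shows "weighted_permutation_matrix B"
proof -
  have "\<exists>i. cmod (B $ i $ j) = 1" for j
  proof -
    have "\<exists>i. B $ i $ j \<noteq> 0"
    proof (rule ccontr)
      assume "\<not> (\<exists>i. B $ i $ j \<noteq> 0)"
      thus False using unitary_matrix_column[OF B, of j] by simp
    qed
    then obtain i where i: "B $ i $ j \<noteq> 0" ..
    have "(\<Sum>k\<in>UNIV. (cmod (B $ k $ j))\<^sup>2) = (\<Sum>k\<in>UNIV. if k = i then (cmod (B $ i $ j))\<^sup>2 else 0)"
      using col[OF i] by (intro sum.cong) auto
    hence "(cmod (B $ i $ j))\<^sup>2 = 1\<^sup>2" using unitary_matrix_column[OF B, of j] by simp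
    hence "cmod (B $ i $ j) = 1" by (rule power2_eq_imp_eq) auto
    thus ?thesis by blast
  qed
  then obtain \<tau> where \<tau>: "\<And>j. cmod (B $ \<tau> j $ j) = 1" by metis
  have "inj \<tau>"
  proof (rule injI, rule ccontr)
    fix j j' assume eq: "\<tau> j = \<tau> j'" and ne: "j \<noteq> j'"
    have "B $ \<tau> j $ j' = 0"
      by (rule unit_sum_other_zero[OF unitary_matrix_row[OF B] \<tau>]) (use ne in simp)
    thus False using \<tau>[of j'] eq by simp
  qed
  hence bij: "bij \<tau>" by (simp add: bij_def finite_UNIV_inj_surj)
  have "cmod (B $ i $ inv \<tau> i) = 1" for i
    using \<tau>[of "inv \<tau> i"] bij by (simp add: bij_def surj_f_inv_f)
  thus ?thesis
    unfolding weighted_permutation_matrix_def using B bij_imp_bij_inv[OF bij] by blast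
qed

section \<open>The Forelli condition\<close>

context intervals
begin

lemma AE_mu_I: "AE y in \<mu>. \<exists>j. y \<in> I j"
  by (rule AE_I2) (auto simp: \<Omega>_eq)

lemma cut_measurable:
  assumes "g \<in> borel_measurable \<mu>"
  shows "cut g k \<in> borel_measurable lebesgue"
proof -
  have "(\<lambda>x. if x \<in> \<Omega> then g x else 0) \<in> borel_measurable lebesgue"
    using assms unfolding \<mu>_def by (simp add: borel_measurable_if)
  hence "(\<lambda>x. if x \<in> I k then if x \<in> \<Omega> then g x else 0 else 0) \<in> borel_measurable lebesgue"
    by (rule measurable_If) simp_all
  also have "(\<lambda>x. if x \<in> I k then if x \<in> \<Omega> then g x else 0 else 0) = cut g k"
    using I_subset[of k] by (auto simp: cut_def fun_eq_iff)
  finally show ?thesis .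
qed

text \<open>The functions are Lebesgue rather than Borel measurable, so the translation has to be
  measurable with respect to the Lebesgue sets on both sides.\<close>

lemma shift_measurable:
  fixes u :: "real \<Rightarrow> complex"
  assumes "u \<in> borel_measurable lebesgue"
  shows "(\<lambda>y. u (y + s)) \<in> borel_measurable lebesgue"
proof -
  have "(\<lambda>x::real. s + 1 * x) \<in> lebesgue \<rightarrow>\<^sub>M lebesgue"
    using lebesgue_affine_measurable[where c = "\<lambda>_::real. 1" and t = s] by simp
  from measurable_compose[OF this assms] show ?thesis by (simp add: add.commute)
qed

lemma pull_measurable:
  assumes "g \<in> borel_measurable \<mu>"
  shows "pull B t g j \<in> borel_measurable lebesgue"
proof -
  have "(\<lambda>y. cut g k (y - s)) \<in> borel_measurable lebesgue" for k s
    using shift_measurable[OF cut_measurable[OF assms], of k "-s"] by simp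
  thus ?thesis
    unfolding pull_def[abs_def]
    by (intro borel_measurable_add borel_measurable_sum borel_measurable_times borel_measurable_const)
qed

text \<open>Right of \<open>\<alpha> j + t\<close> the point \<open>y - t\<close> has not left
  \<open>I j\<close>, while each argument of the sum exceeds \<open>\<beta> k\<close>.\<close>

lemma pull_right:
  assumes y: "y \<in> I j" "\<alpha> j + t < y" and t: "0 \<le> t"
  shows "pull B t f j y = f (y - t)"
proof -
  have "y - t \<in> I j" using y t by (auto simp: I_def)
  moreover have "y - (t - \<beta> k + \<alpha> j) \<notin> I k" for k
    using y by (auto simp: I_def)
  ultimately show ?thesis by (simp add: pull_def cut_def)
qed

text \<open>The point is \<open>\<beta> k - (\<alpha> j + t - y)\<close>: it lies left of
  \<open>\<beta> k\<close> by a positive distance smaller than \<open>t\<close>, hence smaller than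
  the length of \<open>I k\<close>.\<close>

lemma pull_left_mem:
  assumes y: "y \<in> I j" "y < \<alpha> j + t" and t: "t \<le> \<beta> k - \<alpha> k"
  shows "y - (t - \<beta> k + \<alpha> j) \<in> I k"
  using assms by (auto simp: I_def)

lemma pull_left:
  assumes y: "y \<in> I j" "y < \<alpha> j + t" and t: "\<And>k. t \<le> \<beta> k - \<alpha> k"
  shows "pull B t f j y = (\<Sum>k\<in>UNIV. cnj (B $ k $ j) * f (y - (t - \<beta> k + \<alpha> j)))"
proof -
  have "y - t \<notin> I j" using y by (auto simp: I_def)
  thus ?thesis using pull_left_mem[OF y t] by (simp add: pull_def cut_def)
qed

lemma AE_neq: "AE y in \<mu>. \<forall>j. y \<noteq> \<alpha> j + t"
proof -
  have "AE y in lebesgue. y \<noteq> \<alpha> j + t" for j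
    by (rule AE_not_in[of "{\<alpha> j + t}", simplified]) (simp add: null_sets_completionI)
  hence "AE y in lebesgue. \<forall>j. y \<noteq> \<alpha> j + t" by (simp add: AE_all_countable)
  hence "AE y in lebesgue. y \<in> \<Omega> \<longrightarrow> (\<forall>j. y \<noteq> \<alpha> j + t)" by eventually_elim simp
  thus ?thesis unfolding \<mu>_def by (simp add: AE_restrict_space_iff)
qed

text \<open>Every class has the form \<open>U (-t) (cls \<mu> f)\<close>, and on it the conjugated
  operator yields \<open>U (-t)\<close> of \<open>g f\<close>. Inserting the pointwise formula for
  \<open>U (-t)\<close> on both sides turns an equality of operators into one of functions.\<close>

lemma conj_op_mult_pull:
  assumes U: "is_exp_group \<mu> (D_op \<alpha> \<beta> B) U"
    and t: "0 \<le> t" "\<And>k. t \<le> \<beta> k - \<alpha> k"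
    and g: "g \<in> Linf_fun \<mu>" and h: "h \<in> Linf_fun \<mu>"
  shows "conj_op \<mu> U (-t) (mult_op \<mu> g) = mult_op \<mu> h \<longleftrightarrow>
    (\<forall>f\<in>L2_fun \<mu>. AE y in \<mu>. \<forall>j. y \<in> I j \<longrightarrow> pull B t (\<lambda>x. g x * f x) j y = h y * pull B t f j y)"
proof -
  have G: "continuous_unitary_group \<mu> U" using U by (simp add: is_exp_group_def)
  have *: "conj_op \<mu> U (-t) (mult_op \<mu> g) (U (-t) (cls \<mu> f)) = mult_op \<mu> h (U (-t) (cls \<mu> f)) \<longleftrightarrow>
      (AE y in \<mu>. \<forall>j. y \<in> I j \<longrightarrow> pull B t (\<lambda>x. g x * f x) j y = h y * pull B t f j y)"
    if f: "f \<in> L2_fun \<mu>" for f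
  proof -
    have F: "cls \<mu> f \<in> L2 \<mu>" by (rule cls_in_L2[OF f])
    have gf: "(\<lambda>x. g x * f x) \<in> L2_fun \<mu>" by (rule Linf_mult_L2[OF g f])
    define r where "r = rep (U (-t) (cls \<mu> f))"
    define s where "s = rep (U (-t) (cls \<mu> (\<lambda>x. g x * f x)))"
    have r: "r \<in> L2_fun \<mu>" "cls \<mu> r = U (-t) (cls \<mu> f)"
      unfolding r_def by (intro rep_in_L2_fun unitary_group_closed[OF G] F)+
    have s: "s \<in> L2_fun \<mu>" "cls \<mu> s = U (-t) (cls \<mu> (\<lambda>x. g x * f x))"
      unfolding s_def by (intro rep_in_L2_fun unitary_group_closed[OF G] cls_in_L2 gf)+
    have "U t (U (-t) (cls \<mu> f)) = cls \<mu> f"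
      using unitary_group_add[OF G F, of t "-t"] unitary_group_zero[OF G F] by simp
    hence "conj_op \<mu> U (-t) (mult_op \<mu> g) (U (-t) (cls \<mu> f)) = cls \<mu> s"
      using unitary_group_closed[OF G F, of "-t"]
      by (simp add: conj_op_def compose_def mult_op_cls[OF g f] s(2))
    moreover have "mult_op \<mu> h (U (-t) (cls \<mu> f)) = cls \<mu> (\<lambda>x. h x * r x)"
      unfolding r(2)[symmetric] by (rule mult_op_cls[OF h r(1)])
    moreover have "cls \<mu> s = cls \<mu> (\<lambda>x. h x * r x) \<longleftrightarrow> (AE x in \<mu>. s x = h x * r x)"
      by (rule cls_eq_iff[OF s(1) Linf_mult_L2[OF h r(1)]])
    moreover have "(AE x in \<mu>. s x = h x * r x) \<longleftrightarrow>
      (AE y in \<mu>. \<forall>j. y \<in> I j \<longrightarrow> pull B t (\<lambda>x. g x * f x) j y = h y * pull B t f j y)"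
    proof
      assume "AE x in \<mu>. s x = h x * r x"
      with exp_group_pull[OF U t f] exp_group_pull[OF U t gf]
      show "AE y in \<mu>. \<forall>j. y \<in> I j \<longrightarrow> pull B t (\<lambda>x. g x * f x) j y = h y * pull B t f j y"
        unfolding r_def[symmetric] s_def[symmetric] by eventually_elim metis
    next
      assume "AE y in \<mu>. \<forall>j. y \<in> I j \<longrightarrow> pull B t (\<lambda>x. g x * f x) j y = h y * pull B t f j y"
      with exp_group_pull[OF U t f] exp_group_pull[OF U t gf] AE_mu_I
      show "AE x in \<mu>. s x = h x * r x"
        unfolding r_def[symmetric] s_def[symmetric] by eventually_elim metis
    qed
    ultimately show ?thesis by simp
  qed
  show ?thesis
  proof
    assume "conj_op \<mu> U (-t) (mult_op \<mu> g) = mult_op \<mu> h"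
    thus "\<forall>f\<in>L2_fun \<mu>. AE y in \<mu>. \<forall>j. y \<in> I j \<longrightarrow> pull B t (\<lambda>x. g x * f x) j y = h y * pull B t f j y"
      using * by simp
  next
    assume a: "\<forall>f\<in>L2_fun \<mu>. AE y in \<mu>. \<forall>j. y \<in> I j \<longrightarrow> pull B t (\<lambda>x. g x * f x) j y = h y * pull B t f j y"
    show "conj_op \<mu> U (-t) (mult_op \<mu> g) = mult_op \<mu> h"
    proof
      fix F
      show "conj_op \<mu> U (-t) (mult_op \<mu> g) F = mult_op \<mu> h F"
      proof (cases "F \<in> L2 \<mu>")
        case True
        \<comment> \<open>Surjectivity of \<open>U (-t)\<close>: the preimage of \<open>F\<close> is
          \<open>U t F\<close>.\<close>
        obtain f where f: "f \<in> L2_fun \<mu>" "U t F = cls \<mu> f"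
          using unitary_group_closed[OF G True] by (rule L2_obtain)
        have Ff: "U (-t) (cls \<mu> f) = F"
          using unitary_group_add[OF G True, of "-t" t] unitary_group_zero[OF G True] f(2) by simp
        from *[OF f(1)] bspec[OF a f(1)] show ?thesis unfolding Ff by (rule iffD2)
      next
        case False
        thus ?thesis by (simp add: conj_op_def compose_def mult_op_def)
      qed
    qed
  qed
qed

lemma small_time_exists:
  obtains e where "e > 0" "\<And>k. e < \<beta> k - \<alpha> k"
proof
  let ?m = "Min (range (\<lambda>k. \<beta> k - \<alpha> k))"
  have m: "?m > 0" using len by (simp add: Min_gr_iff)
  thus "?m / 2 > 0" by simp
  show "?m / 2 < \<beta> k - \<alpha> k" for k
  proof -
    have "?m \<le> \<beta> k - \<alpha> k" by (intro Min_le) auto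
    thus ?thesis using m by linarith
  qed
qed

lemma indicator_Linf: "(indicator (I i) :: real \<Rightarrow> complex) \<in> Linf_fun \<mu>"
  and indicator_L2: "(indicator (I i) :: real \<Rightarrow> complex) \<in> L2_fun \<mu>"
proof -
  have "I i \<in> sets \<mu>" using I_subset unfolding \<mu>_def by (simp add: sets_restrict_space_iff)
  hence m: "(indicator (I i) :: real \<Rightarrow> complex) \<in> borel_measurable \<mu>" by simp
  show "(indicator (I i) :: real \<Rightarrow> complex) \<in> L2_fun \<mu>"
    by (rule bounded_L2(1)[where C = 1, OF m]) (simp add: indicator_def)
  show "(indicator (I i) :: real \<Rightarrow> complex) \<in> Linf_fun \<mu>"
    using m unfolding Linf_fun_def by (auto intro!: exI[of _ 1] simp: indicator_def)
qed

lemma indicator_I: "x \<in> I k \<Longrightarrow> indicator (I i) x = (if k = i then 1 else 0 :: complex)"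
  by (auto simp: indicator_def dest: I_disjoint)

text \<open>If two entries of a column of \<open>B\<close> were nonzero, then \<open>U(-t)\<close> would superpose the contents
  of two intervals, while multiplication by an indicator function separates them.\<close>

lemma forelli_imp_weighted_permutation:
  assumes U: "is_exp_group \<mu> (D_op \<alpha> \<beta> B) U" and B: "unitary_matrix B"
    and fo: "group_forelli \<mu> U"
  shows "weighted_permutation_matrix B"
proof (rule weighted_permutation_if_columns[OF B], rule ccontr)
  fix i i' j assume nz: "B $ i $ j \<noteq> 0" "B $ i' $ j \<noteq> 0" and ne: "i \<noteq> i'"
  have G: "continuous_unitary_group \<mu> U" using U by (simp add: is_exp_group_def)
  obtain t where t0: "t > 0" and t1: "\<And>k. t < \<beta> k - \<alpha> k" using small_time_exists by blast
  have t: "0 \<le> t" "\<And>k. t \<le> \<beta> k - \<alpha> k" using t0 t1 by (auto intro: less_imp_le)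
  let ?g = "indicator (I i) :: real \<Rightarrow> complex" and ?g' = "indicator (I i') :: real \<Rightarrow> complex"
  have "conj_op \<mu> U (-t) (mult_op \<mu> ?g) \<in> conj_op \<mu> U (-t) ` mult_algebra \<mu>"
    by (intro imageI) (simp add: mult_algebra_def indicator_Linf)
  also have "\<dots> = mult_algebra \<mu>"
    using fo G by (simp add: group_forelli_def forelli_iff_conj_op)
  finally obtain h where h: "h \<in> Linf_fun \<mu>" "conj_op \<mu> U (-t) (mult_op \<mu> ?g) = mult_op \<mu> h"
    unfolding mult_algebra_def by blast
  have key: "AE y in \<mu>. \<forall>j. y \<in> I j \<longrightarrow> pull B t (\<lambda>x. ?g x * f x) j y = h y * pull B t f j y"
    if "f \<in> L2_fun \<mu>" for f
    using h(2) that unfolding conj_op_mult_pull[OF U t indicator_Linf h(1)] by blast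
  \<comment> \<open>Test functions are the indicators of \<open>I i\<close> and \<open>I i'\<close>.
    On \<open>(\<alpha> j, \<alpha> j + t)\<close> their pullbacks are the nonzero constants
    \<open>cnj (B $ i $ j)\<close> and \<open>cnj (B $ i' $ j)\<close>. The first forces
    \<open>h y = 1\<close>, the second \<open>h y = 0\<close>, so this interval of length
    \<open>t\<close> would be null.\<close>
  have "AE y in \<mu>. \<not> y \<in> {\<alpha> j<..<\<alpha> j + t}"
    using key[OF indicator_L2[of i]] key[OF indicator_L2[of i']]
  proof eventually_elim
    case (elim y)
    show ?case
    proof
      assume "y \<in> {\<alpha> j<..<\<alpha> j + t}"
      hence y: "y \<in> I j" "y < \<alpha> j + t" using t1[of j] by (auto simp: I_def)
      have pl: "pull B t (indicator (I l)) j y = cnj (B $ l $ j)" for l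
        unfolding pull_left[OF y t(2)] indicator_I[OF pull_left_mem[OF y t(2)]]
        by (simp add: if_distrib cong: if_cong)
      have "pull B t (\<lambda>x. ?g x * ?g x) j y = cnj (B $ i $ j)"
        unfolding pl[symmetric] by (intro arg_cong[where f = "\<lambda>f. pull B t f j y"]) (auto simp: indicator_def)
      hence 1: "h y * cnj (B $ i $ j) = cnj (B $ i $ j)" using elim(1) y(1) pl by simp
      have "pull B t (\<lambda>x. ?g x * ?g' x) j y = 0"
        unfolding pull_left[OF y t(2)] indicator_I[OF pull_left_mem[OF y t(2)]]
        using ne by (intro sum.neutral) auto
      hence 2: "h y * cnj (B $ i' $ j) = 0" using elim(2) y(1) pl by simp
      from 1 2 nz show False by simp
    qed
  qed
  hence "AE y in lebesgue. y \<notin> {\<alpha> j<..<\<alpha> j + t}"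
  proof -
    assume "AE y in \<mu>. \<not> y \<in> {\<alpha> j<..<\<alpha> j + t}"
    hence "AE y in lebesgue. y \<in> \<Omega> \<longrightarrow> \<not> y \<in> {\<alpha> j<..<\<alpha> j + t}"
      unfolding \<mu>_def by (simp add: AE_restrict_space_iff)
    moreover have "y \<in> \<Omega>" if "y \<in> {\<alpha> j<..<\<alpha> j + t}" for y
      using that t1[of j] I_subset[of j] by (auto simp: I_def)
    ultimately show ?thesis by (auto elim: AE_mp)
  qed
  hence "{\<alpha> j<..<\<alpha> j + t} \<in> null_sets lebesgue"
    by (subst (asm) AE_iff_null_sets[symmetric]) auto
  hence "emeasure lborel {\<alpha> j<..<\<alpha> j + t} = 0"
    by (simp add: null_sets_def)
  thus False using t0 by simp
qed

lemma glue_Linf: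
  assumes m: "\<And>k. g k \<in> borel_measurable lebesgue" and C: "\<And>k x. cmod (g k x) \<le> C"
  shows "glue g \<in> Linf_fun \<mu>"
proof -
  have "AE x in \<mu>. cmod (glue g x) \<le> C"
  proof (rule AE_I2)
    fix x assume "x \<in> space \<mu>"
    then obtain k where "x \<in> I k" by (auto elim: \<Omega>_cases)
    thus "cmod (glue g x) \<le> C" using C by (simp add: glue_eq)
  qed
  thus ?thesis using glue_measurable(2)[of g] m by (auto simp: Linf_fun_def)
qed

text \<open>The pattern of \<open>B\<close> with its weights removed; with it \<open>pull\<close>
  describes how symbols, rather than functions, are transported.\<close>

definition perm_matrix :: "('n \<Rightarrow> 'n) \<Rightarrow> complex^('n::{finite,linorder})^('n::{finite,linorder})" where
  "perm_matrix \<sigma> = (\<chi> i j. if j = \<sigma> i then 1 else 0)"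

text \<open>For small \<open>t\<close>, \<open>pull B t\<close> is composition with a point map
  followed by multiplication with a phase. Composition respects products and the phase is applied
  once, so the pullback of \<open>g f\<close> is the unweighted pullback of \<open>g\<close> times
  the weighted pullback of \<open>f\<close>.\<close>

lemma weighted_permutation_imp_forelli:
  assumes U: "is_exp_group \<mu> (D_op \<alpha> \<beta> B) U" and wp: "weighted_permutation_matrix B"
  shows "group_forelli \<mu> U"
proof -
  have G: "continuous_unitary_group \<mu> U" using U by (simp add: is_exp_group_def)
  obtain \<sigma> where \<sigma>: "bij \<sigma>" "\<And>i. cmod (B $ i $ \<sigma> i) = 1" and B: "unitary_matrix B"
    using wp unfolding weighted_permutation_matrix_def by blast
  have Bz: "B $ i $ j = 0" if "j \<noteq> \<sigma> i" for i j
    by (rule unit_sum_other_zero[OF unitary_matrix_row[OF B] \<sigma>(2) that])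
  \<comment> \<open>On \<open>I j\<close> the sum in \<open>pull\<close> runs down column
    \<open>j\<close>, whose only nonzero entry stands in row \<open>\<tau> j\<close>.\<close>
  define \<tau> where "\<tau> = inv \<sigma>"
  have \<tau>\<sigma>: "\<sigma> (\<tau> j) = j" "\<tau> (\<sigma> j) = j" for j
    using \<sigma>(1) by (simp_all add: \<tau>_def bij_def surj_f_inv_f)
  have B\<tau>: "B $ k $ j = (if k = \<tau> j then B $ \<tau> j $ j else 0)" for j k
    using Bz[of j k] \<tau>\<sigma>(2)[of k] by (cases "j = \<sigma> k") auto
  define P where "P = perm_matrix \<sigma>"
  have P\<tau>: "P $ k $ j = (if k = \<tau> j then 1 else 0)" for j k
    using \<tau>\<sigma>(1)[of j] \<tau>\<sigma>(2)[of k] by (auto simp: P_def perm_matrix_def)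
  obtain e where e0: "e > 0" and e1: "\<And>k. e < \<beta> k - \<alpha> k" using small_time_exists by blast
  show ?thesis
  proof (rule group_forelli_if_small[OF G e0])
    fix t :: real assume t0: "0 \<le> t" and te: "t < e"
    have t: "t \<le> \<beta> k - \<alpha> k" for k using te e1[of k] by linarith
    have pullB: "pull B t f j y = cnj (B $ \<tau> j $ j) * f (y - (t - \<beta> (\<tau> j) + \<alpha> j))"
      if "y \<in> I j" "y < \<alpha> j + t" for f j y
    proof -
      have "pull B t f j y = (\<Sum>k\<in>UNIV. if k = \<tau> j then cnj (B $ \<tau> j $ j) * f (y - (t - \<beta> (\<tau> j) + \<alpha> j)) else 0)"
        unfolding pull_left[OF that t] by (intro sum.cong refl) (subst B\<tau>, simp)
      thus ?thesis by simp
    qed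
    have pullP: "pull P t f j y = f (y - (t - \<beta> (\<tau> j) + \<alpha> j))"
      if "y \<in> I j" "y < \<alpha> j + t" for f j y
    proof -
      have "pull P t f j y = (\<Sum>k\<in>UNIV. if k = \<tau> j then f (y - (t - \<beta> (\<tau> j) + \<alpha> j)) else 0)"
        unfolding pull_left[OF that t] by (intro sum.cong refl) (simp add: P\<tau>)
      thus ?thesis by simp
    qed
    \<comment> \<open>Identities are checked on either side of \<open>\<alpha> j + t\<close>, where
      \<open>pull\<close> changes its form; the finitely many points in between form a null
      set.\<close>
    have AEc: "AE y in \<mu>. Q y" if "\<And>y j. y \<in> I j \<Longrightarrow> \<alpha> j + t < y \<Longrightarrow> Q y"
      "\<And>y j. y \<in> I j \<Longrightarrow> y < \<alpha> j + t \<Longrightarrow> Q y" for Q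
      using AE_mu_I AE_neq[of t]
    proof eventually_elim
      case (elim y)
      then obtain j where "y \<in> I j" "y \<noteq> \<alpha> j + t" by blast
      thus ?case using that by (meson linorder_neqE_linordered_idom)
    qed
    have pull_Linf: "glue (pull P t g) \<in> Linf_fun \<mu>"
      if g: "g \<in> Linf_fun \<mu>" and C: "\<And>x. cmod (g x) \<le> C" "C \<ge> 0" for g C
    proof (rule glue_Linf)
      show "pull P t g k \<in> borel_measurable lebesgue" for k
        using g by (intro pull_measurable) (simp add: Linf_fun_def)
      \<comment> \<open>One \<open>C\<close> for the translated term and one for each interval: a
        crude bound, valid at every point of the line.\<close>
      show "cmod (pull P t g k x) \<le> C + (\<Sum>i\<in>(UNIV::'n set). C)" for k x
      proof -
        have c: "cmod (cut g i z) \<le> C" for i z using C by (simp add: cut_def)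
        have "cmod (cnj (P $ i $ k) * cut g i z) \<le> C" for i z
          using c[of i z] C(2) by (auto simp: norm_mult P\<tau>)
        thus ?thesis
          unfolding pull_def by (intro order_trans[OF norm_triangle_ineq] add_mono c sum_norm_le)
      qed
    qed
    have conj: "conj_op \<mu> U (-t) (mult_op \<mu> g) = mult_op \<mu> (glue (pull P t g))"
      if g: "g \<in> Linf_fun \<mu>" and C: "\<And>x. cmod (g x) \<le> C" "C \<ge> 0" for g C
      unfolding conj_op_mult_pull[OF U t0 t g pull_Linf[OF g C]]
    proof
      fix f assume "f \<in> L2_fun \<mu>"
      show "AE y in \<mu>. \<forall>j. y \<in> I j \<longrightarrow> pull B t (\<lambda>x. g x * f x) j y = glue (pull P t g) y * pull B t f j y"
      proof (rule AEc; intro allI impI)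
        fix y i j assume "y \<in> I i" "\<alpha> i + t < y" "y \<in> I j"
        moreover from this have "i = j" by (intro I_disjoint)
        ultimately show "pull B t (\<lambda>x. g x * f x) j y = glue (pull P t g) y * pull B t f j y"
          using t0 by (simp add: glue_eq pull_right)
      next
        fix y i j assume "y \<in> I i" "y < \<alpha> i + t" "y \<in> I j"
        moreover from this have "i = j" by (intro I_disjoint)
        ultimately show "pull B t (\<lambda>x. g x * f x) j y = glue (pull P t g) y * pull B t f j y"
          by (simp add: glue_eq pullB pullP)
      qed
    qed
    show "conj_op \<mu> U (-t) ` mult_algebra \<mu> = mult_algebra \<mu>"
    proof
      show "conj_op \<mu> U (-t) ` mult_algebra \<mu> \<subseteq> mult_algebra \<mu>"
      proof (clarsimp simp: mult_algebra_def)
        fix g assume "g \<in> Linf_fun \<mu>"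
        then obtain g' C where g': "g' \<in> Linf_fun \<mu>" "mult_op \<mu> g' = mult_op \<mu> g" "\<And>x. cmod (g' x) \<le> C" "C \<ge> 0"
          by (rule Linf_bounded_representative) blast
        show "conj_op \<mu> U (-t) (mult_op \<mu> g) \<in> mult_op \<mu> ` Linf_fun \<mu>"
          unfolding g'(2)[symmetric] conj[OF g'(1,3,4)] by (intro imageI pull_Linf[OF g'(1,3,4)])
      qed
      show "mult_algebra \<mu> \<subseteq> conj_op \<mu> U (-t) ` mult_algebra \<mu>"
      proof
        fix S assume "S \<in> mult_algebra \<mu>"
        then obtain h0 where "h0 \<in> Linf_fun \<mu>" "S = mult_op \<mu> h0" by (auto simp: mult_algebra_def)
        then obtain h C where h: "h \<in> Linf_fun \<mu>" "S = mult_op \<mu> h" and C: "\<And>x. cmod (h x) \<le> C" "C \<ge> 0"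
          by (metis Linf_bounded_representative)
        \<comment> \<open>The candidate preimage inverts the point map of \<open>pull P t\<close>:
          from \<open>x\<close> in \<open>I i\<close> move right by \<open>t\<close>, and on passing
          \<open>\<beta> i\<close> continue from \<open>\<alpha> (\<sigma> i)\<close>. If
          \<open>x + t = \<beta> i\<close>, the argument is the endpoint
          \<open>\<alpha> (\<sigma> i)\<close> and \<open>cut\<close> supplies the value 0.\<close>
        define g where "g = glue (\<lambda>i x. if x + t < \<beta> i then cut h i (x + t)
          else cut h (\<sigma> i) (x + (t - \<beta> i + \<alpha> (\<sigma> i))))"
        have c: "cmod (cut h i z) \<le> C" for i z using C by (simp add: cut_def)
        have gL: "g \<in> Linf_fun \<mu>"
          unfolding g_def
        proof (rule glue_Linf)
          fix i
          have hm: "h \<in> borel_measurable \<mu>" using h(1) by (simp add: Linf_fun_def)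
          have "{x. x + t < \<beta> i} = {..<\<beta> i - t}" by auto
          hence "{x \<in> space lebesgue. x + t < \<beta> i} \<in> sets lebesgue" by simp
          thus "(\<lambda>x. if x + t < \<beta> i then cut h i (x + t) else cut h (\<sigma> i) (x + (t - \<beta> i + \<alpha> (\<sigma> i))))
            \<in> borel_measurable lebesgue"
            by (intro measurable_If shift_measurable cut_measurable hm)
        qed (use c in auto)
        have gC: "cmod (g x) \<le> C" for x
        proof (cases "x \<in> \<Omega>")
          case True
          then obtain k where "x \<in> I k" by (rule \<Omega>_cases)
          thus ?thesis using c by (simp add: g_def glue_eq)
        next
          case False
          hence "x \<notin> I k" for k using I_subset by blast
          thus ?thesis using C(2) by (simp add: g_def glue_def)
        qed
        have "AE y in \<mu>. glue (pull P t g) y = h y"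
        proof (rule AEc)
          fix y j assume y: "y \<in> I j" "\<alpha> j + t < y"
          have "y - t \<in> I j" using y t0 by (auto simp: I_def)
          moreover have "y < \<beta> j" using y by (simp add: I_def)
          ultimately have "g (y - t) = h y" using y(1) by (simp add: g_def glue_eq cut_def)
          thus "glue (pull P t g) y = h y" using y t0 by (simp add: glue_eq pull_right)
        next
          fix y j assume y: "y \<in> I j" "y < \<alpha> j + t"
          define x where "x = y - (t - \<beta> (\<tau> j) + \<alpha> j)"
          have x: "x \<in> I (\<tau> j)" unfolding x_def by (rule pull_left_mem[OF y t])
          \<comment> \<open>Since \<open>y > \<alpha> j\<close>, the point \<open>x + t\<close> lies
            beyond \<open>\<beta> (\<tau> j)\<close>: the second branch in the definition of
            \<open>g\<close> applies and leads back to \<open>y\<close>.\<close>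
          have "\<not> x + t < \<beta> (\<tau> j)" using y(1) by (simp add: x_def I_def)
          moreover have "x + (t - \<beta> (\<tau> j) + \<alpha> j) = y" by (simp add: x_def)
          ultimately have "g x = h y" using x y(1) by (simp add: g_def glue_eq cut_def \<tau>\<sigma>)
          thus "glue (pull P t g) y = h y" using y by (simp add: glue_eq pullP x_def)
        qed
        hence "mult_op \<mu> (glue (pull P t g)) = mult_op \<mu> h"
          using h(1) by (intro mult_op_cong(2)[OF pull_Linf[OF gL gC C(2)]]) (simp_all add: Linf_fun_def)
        hence "S = conj_op \<mu> U (-t) (mult_op \<mu> g)"
          using conj[OF gL gC C(2)] h(2) by simp
        thus "S \<in> conj_op \<mu> U (-t) ` mult_algebra \<mu>"
          using gL by (auto simp: mult_algebra_def)
      qed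
    qed
  qed
qed

end

theorem theorem4p13:
  fixes \<alpha> \<beta> :: "'n::{finite,linorder} \<Rightarrow> real"
    and B :: "complex^('n::{finite,linorder})^('n::{finite,linorder})"
    and U :: "real \<Rightarrow> real fclass \<Rightarrow> real fclass"
  assumes "\<And>i. \<alpha> i < \<beta> i"
    and "\<And>i j. i < j \<Longrightarrow> \<beta> i < \<alpha> j"
    and "unitary_matrix B"
    and "is_exp_group (lebesgue_on (region \<alpha> \<beta>)) (D_op \<alpha> \<beta> B) U"
  shows "group_forelli (lebesgue_on (region \<alpha> \<beta>)) U \<longleftrightarrow> weighted_permutation_matrix B"
proof -
  interpret intervals \<alpha> \<beta> using assms(1,2) by unfold_locales
  have "is_exp_group \<mu> (D_op \<alpha> \<beta> B) U"
    using assms(4) by (simp only: \<mu>_def \<Omega>_def)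
  from forelli_imp_weighted_permutation[OF this assms(3)] weighted_permutation_imp_forelli[OF this]
  show ?thesis by (auto simp only: \<mu>_def \<Omega>_def)
qed

end
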